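(* The solutions $\mathbf{E}^{t_{end}},\mathbf{H}^{t_{end}}$ produced by the fully discrete scheme defined in the context satisfy the discrete energy conservation laws $$\mathcal{E}_1^{t_{end}}=\mathcal{E}_1^0,\quad \mathcal{E}_2^{t_{end}}=\mathcal{E}_2^0,\quad \mathcal{E}_3^{t_{end}}=\mathcal{E}_3^0,\quad \mathcal{E}_4^{t_{end}}=\mathcal{E}_4^0,\quad \mathcal{E}_5^{t_{end}}=\mathcal{E}_5^0,\quad \mathcal{E}_6^{t_{end}}=\mathcal{E}_6^0,$$ where $$\mathcal{E}_1^t=\tfrac\mu2\langle\mathbf{H}^t,\mathbf{H}^t\rangle_N+\tfrac\varepsilon2\langle\mathbf{E}^t,\mathbf{E}^t\rangle_N,$$ $$\mathcal{E}_2^t=\tfrac\mu2\Big\langle\tfrac{d}{dt}\mathbf{H}^t,\tfrac{d}{dt}\mathbf{H}^t\Big\rangle_N+\tfrac\varepsilon2\Big\langle\tfrac{d}{dt}\mathbf{E}^t,\tfrac{d}{dt}\mathbf{E}^t\Big\rangle_N,$$ and, for each $k=1,2,3$, $$\mathcal{E}_3^t=\tfrac\mu2\sum_{w=x,y,z}\langle\mathbf{D}_k\mathbf{H}_w^t,\mathbf{D}_k\mathbf{H}_w^t\rangle_N+\tfrac\varepsilon2\sum_{w=x,y,z}\langle\mathbf{D}_k\mathbf{E}_w^t,\mathbf{D}_k\mathbf{E}_w^t\rangle_N,$$ $$\mathcal{E}_4^t=\tfrac\mu2\sum_{w=x,y,z}\Big\langle\mathbf{D}_k\tfrac{d}{dt}\mathbf{H}_w^t,\mathbf{D}_k\tfrac{d}{dt}\mathbf{H}_w^t\Big\rangle_N+\tfrac\varepsilon2\sum_{w=x,y,z}\Big\langle\mathbf{D}_k\tfrac{d}{dt}\mathbf{E}_w^t,\mathbf{D}_k\tfrac{d}{dt}\mathbf{E}_w^t\Big\rangle_N,$$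 $$\mathcal{E}_5^t=\tfrac\mu2\sum_{w=x,y,z}\langle\mathbf{H}_w^t,\mathbf{D}_k\mathbf{H}_w^t\rangle_N+\tfrac\varepsilon2\sum_{w=x,y,z}\langle\mathbf{E}_w^t,\mathbf{D}_k\mathbf{E}_w^t\rangle_N,$$ $$\mathcal{E}_6^t=\tfrac\mu2\sum_{w=x,y,z}\Big\langle\tfrac{d}{dt}\mathbf{H}_w^t,\mathbf{D}_k\tfrac{d}{dt}\mathbf{H}_w^t\Big\rangle_N+\tfrac\varepsilon2\sum_{w=x,y,z}\Big\langle\tfrac{d}{dt}\mathbf{E}_w^t,\mathbf{D}_k\tfrac{d}{dt}\mathbf{E}_w^t\Big\rangle_N,$$ with $\mathbf{D}_1=I_{N_z}\otimes I_{N_y}\otimes D_x$, $\mathbf{D}_2=I_{N_z}\otimes D_y\otimes I_{N_x}$, $\mathbf{D}_3=D_z\otimes I_{N_y}\otimes I_{N_x}$.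
   Context: **Setting.** $\varepsilon,\mu>0$ are constants. The scheme approximates Maxwell's equations $\partial_t\mathbf{H}=-\frac1\mu\mathbf{curl}\,\mathbf{E}$, $\partial_t\mathbf{E}=\frac1\varepsilon\mathbf{curl}\,\mathbf{H}$, $\nabla\cdot(\varepsilon\mathbf{E})=0$, $\nabla\cdot(\varepsilon\mathbf{H})=0$ for $\mathbb{R}^3$-valued $\mathbf{H}=(H_x,H_y,H_z)^\intercal$, $\mathbf{E}=(E_x,E_y,E_z)^\intercal$ on $\Omega\times[0,t_{end}]$, $\Omega=[x_L,x_R]\times[y_L,y_R]\times[z_L,z_R]$, with periodic boundary conditions and given initial values. **Grid.** For $w\in\{x,y,z\}$, $N_w$ is a positive even integer, $h_w=(w_R-w_L)/N_w$, $x_j=x_L+(j-1)h_x$, $y_k=y_L+(k-1)h_y$, $z_l=z_L+(l-1)h_z$ for $1\le j\le N_x$, $1\le k\le N_y$, $1\le l\le N_z$. A grid function is identified with the vector in $\mathbb{C}^{N_xN_yN_z}$ whose entry number $N_xN_y(l-1)+N_x(k-1)+j$ is its value at $(x_j,y_k,z_l)$. $I_m$ is the $m\times m$ identity and $\otimes$ the Kronecker product. $\langle u,v\rangle_N=\frac1{N_xN_yN_z}\sum_{j,k,l}u_{j,k,l}\overline{v_{j,k,l}}$, summed over the three components for vector fields. **Matrices.** $\nu_w=2\pi/(w_R-w_L)$. $D_w$ is the $N_w\times N_w$ spectral differentiation matrix with $(D_w)_{j,l}=\frac12\nu_w(-1)^{j+l}\cot(\nu_w(w_j-w_l)/2)$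 for $j\ne l$ and zero diagonal. $\mathcal{F}_{N_w}$ is the DFT matrix with entries $(e^{2\pi\mathrm{i}/N_w})^{-jk}$, $0\le j,k\le N_w-1$, and $\mathcal{F}_{N_w}^{-1}$ its inverse, with entries $\frac1{N_w}(e^{2\pi\mathrm{i}/N_w})^{jk}$. Put $\Omega_w=\nu_w\,\mathrm{diag}(0,1,\ldots,\frac{N_w}2-1,0,-\frac{N_w}2+1,\ldots,-2,-1)$, $\Omega_1=I_{N_z}\otimes I_{N_y}\otimes\Omega_x$, $\Omega_2=I_{N_z}\otimes\Omega_y\otimes I_{N_x}$, $\Omega_3=\Omega_z\otimes I_{N_y}\otimes I_{N_x}$. For $\tau\ge0$ put $\Psi=\tau^2(\Omega_1^2+\Omega_2^2+\Omega_3^2)$ and let $A=\frac{\cosh(\sqrt{-\Psi})-I}{\Psi}$, $B=\frac{\sinh(\sqrt{-\Psi})}{\sqrt{-\Psi}}$ be the diagonal matrices obtained entrywise (with the value by continuity, $-1/2$ and $1$ respectively, where the diagonal entry of $\Psi$ is $0$). Define $\mathbf{c}_{11}=I+\tau^2(\Omega_3^2+\Omega_2^2)A$, $\mathbf{c}_{22}=I+\tau^2(\Omega_3^2+\Omega_1^2)A$, $\mathbf{c}_{33}=I+\tau^2(\Omega_2^2+\Omega_1^2)A$, $\mathbf{c}_{12}=-\tau^2\Omega_2\Omega_1A$, $\mathbf{c}_{13}=-\tau^2\Omega_3\Omega_1A$, $\mathbf{c}_{23}=-\tau^2\Omega_3\Omega_2A$, $\mathbf{s}_{12}=\mathrm{i}\tau\Omega_3B$,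 $\mathbf{s}_{13}=\mathrm{i}\tau\Omega_2B$, $\mathbf{s}_{23}=\mathrm{i}\tau\Omega_1B$. **Fully discrete scheme.** Let $\mathbf{E}^0_w,\mathbf{H}^0_w$ be the (real) vectors of values of $E_w(\cdot,0),H_w(\cdot,0)$ at the grid points, and $\widehat{\mathbf{E}}^0_w=(\mathcal{F}_{N_z}\otimes\mathcal{F}_{N_y}\otimes\mathcal{F}_{N_x})\mathbf{E}^0_w$, $\widehat{\mathbf{H}}^0_w=(\mathcal{F}_{N_z}\otimes\mathcal{F}_{N_y}\otimes\mathcal{F}_{N_x})\mathbf{H}^0_w$. For a time $t\ge0$, with $\tau=t/\sqrt{\mu\varepsilon}$, $$\mathbf{c}=\begin{pmatrix}\mathbf{c}_{11}&\mathbf{c}_{12}&\mathbf{c}_{13}\\\mathbf{c}_{12}&\mathbf{c}_{22}&\mathbf{c}_{23}\\\mathbf{c}_{13}&\mathbf{c}_{23}&\mathbf{c}_{33}\end{pmatrix},\qquad \mathbf{s}=\begin{pmatrix}\mathbf{0}&-\mathbf{s}_{12}&\mathbf{s}_{13}\\\mathbf{s}_{12}&\mathbf{0}&-\mathbf{s}_{23}\\-\mathbf{s}_{13}&\mathbf{s}_{23}&\mathbf{0}\end{pmatrix},$$ and $\widehat{\mathbf{E}}=(\widehat{\mathbf{E}}_x,\widehat{\mathbf{E}}_y,\widehat{\mathbf{E}}_z)^\intercal$, $\widehat{\mathbf{H}}=(\widehat{\mathbf{H}}_x,\widehat{\mathbf{H}}_y,\widehat{\mathbf{H}}_z)^\intercal$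 (stacked), set $$\sqrt\mu\,\widehat{\mathbf{H}}^{t}=\sqrt\mu\,\mathbf{c}\,\widehat{\mathbf{H}}^0-\sqrt\varepsilon\,\mathbf{s}\,\widehat{\mathbf{E}}^0,\qquad \sqrt\varepsilon\,\widehat{\mathbf{E}}^{t}=\sqrt\varepsilon\,\mathbf{c}\,\widehat{\mathbf{E}}^0+\sqrt\mu\,\mathbf{s}\,\widehat{\mathbf{H}}^0,$$ $\mathbf{E}^{t}_w=(\mathcal{F}^{-1}_{N_z}\otimes\mathcal{F}^{-1}_{N_y}\otimes\mathcal{F}^{-1}_{N_x})\widehat{\mathbf{E}}^{t}_w$, $\mathbf{H}^{t}_w=(\mathcal{F}^{-1}_{N_z}\otimes\mathcal{F}^{-1}_{N_y}\otimes\mathcal{F}^{-1}_{N_x})\widehat{\mathbf{H}}^{t}_w$ for $w=x,y,z$, and $\mathbf{E}^t=(\mathbf{E}^t_x,\mathbf{E}^t_y,\mathbf{E}^t_z)^\intercal$, $\mathbf{H}^t=(\mathbf{H}^t_x,\mathbf{H}^t_y,\mathbf{H}^t_z)^\intercal$. The scheme's output is the case $t=t_{end}$; $\frac{d}{dt}\mathbf{E}^t,\frac{d}{dt}\mathbf{H}^t$ denote derivatives of these vector functions of $t$. *)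

theory Defs
  imports "HOL-Analysis.Derivative" "Jordan_Normal_Form.Matrix"
begin

unbundle no inner_syntax

datatype axis = AX | AY | AZ

text \<open>
  A family indexed by \<^typ>\<open>axis\<close> collects the data of the three coordinate directions, or the three
  components of a vector field: \<open>N w\<close>, \<open>L w\<close>, \<open>R w\<close> are the number of grid points and the endpoints
  of the interval in direction \<open>w\<close>, and an \<open>axis \<Rightarrow> complex vec\<close> is a stacked vector of three
  grid functions.  All indices start at 0, so the node called \<open>w_j\<close> in 1-based numbering
  is \<open>node N L R w (j - 1)\<close>.
\<close>

section \<open>Grid\<close>

definition grid_size :: "(axis \<Rightarrow> nat) \<Rightarrow> nat" where
  "grid_size N = N AX * N AY * N AZ"

definition node :: "(axis \<Rightarrow> nat) \<Rightarrow> (axis \<Rightarrow> real) \<Rightarrow> (axis \<Rightarrow> real) \<Rightarrow> axis \<Rightarrow> nat \<Rightarrow> real" where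
  "node N L R w j = L w + real j * ((R w - L w) / real (N w))"

text \<open>The position \<open>N\<^sub>x N\<^sub>y l + N\<^sub>x k + j\<close> of a grid vector carries the value at \<open>(x\<^sub>j, y\<^sub>k, z\<^sub>l)\<close>.\<close>

definition sample ::
  "(axis \<Rightarrow> nat) \<Rightarrow> (axis \<Rightarrow> real) \<Rightarrow> (axis \<Rightarrow> real) \<Rightarrow> (real \<times> real \<times> real \<Rightarrow> real) \<Rightarrow> complex vec" where
  "sample N L R f = Matrix.vec (grid_size N) (\<lambda>i. complex_of_real (f
     (node N L R AX (i mod N AX),
      node N L R AY (i div N AX mod N AY),
      node N L R AZ (i div (N AX * N AY)))))"

definition grid_inner :: "(axis \<Rightarrow> nat) \<Rightarrow> complex vec \<Rightarrow> complex vec \<Rightarrow> complex" where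
  "grid_inner N u v = (u \<bullet>c v) / of_nat (grid_size N)"

definition field_inner ::
  "(axis \<Rightarrow> nat) \<Rightarrow> (axis \<Rightarrow> complex vec) \<Rightarrow> (axis \<Rightarrow> complex vec) \<Rightarrow> complex" where
  "field_inner N U V = (\<Sum>w\<in>{AX, AY, AZ}. grid_inner N (U w) (V w))"

section \<open>Matrices\<close>

definition kronecker :: "complex mat \<Rightarrow> complex mat \<Rightarrow> complex mat" where
  "kronecker P Q = Matrix.mat (dim_row P * dim_row Q) (dim_col P * dim_col Q) (\<lambda>(i, j).
     P $$ (i div dim_row Q, j div dim_col Q) * Q $$ (i mod dim_row Q, j mod dim_col Q))"

text \<open>The \<open>z\<close> factor comes first because the \<open>x\<close> index runs fastest in a grid vector.\<close>

definition kronecker3 :: "(axis \<Rightarrow> complex mat) \<Rightarrow> complex mat" where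
  "kronecker3 M = kronecker (M AZ) (kronecker (M AY) (M AX))"

definition on_axis :: "(axis \<Rightarrow> nat) \<Rightarrow> axis \<Rightarrow> complex mat \<Rightarrow> complex mat" where
  "on_axis N w M = kronecker3 ((\<lambda>v. 1\<^sub>m (N v))(w := M))"

definition nu :: "(axis \<Rightarrow> real) \<Rightarrow> (axis \<Rightarrow> real) \<Rightarrow> axis \<Rightarrow> real" where
  "nu L R w = 2 * pi / (R w - L w)"

definition diff_mat ::
  "(axis \<Rightarrow> nat) \<Rightarrow> (axis \<Rightarrow> real) \<Rightarrow> (axis \<Rightarrow> real) \<Rightarrow> axis \<Rightarrow> complex mat" where
  "diff_mat N L R w = Matrix.mat (N w) (N w) (\<lambda>(j, l). if j = l then 0 else complex_of_real
     (1 / 2 * nu L R w * (-1) ^ (j + l) * cot (nu L R w * (node N L R w j - node N L R w l) / 2)))"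

definition grid_diff ::
  "(axis \<Rightarrow> nat) \<Rightarrow> (axis \<Rightarrow> real) \<Rightarrow> (axis \<Rightarrow> real) \<Rightarrow> axis \<Rightarrow> complex mat" where
  "grid_diff N L R w = on_axis N w (diff_mat N L R w)"

definition dft :: "nat \<Rightarrow> complex mat" where
  "dft n = Matrix.mat n n (\<lambda>(j, k). exp (2 * of_real pi * \<i> / of_nat n) powi (- int (j * k)))"

definition inv_dft :: "nat \<Rightarrow> complex mat" where
  "inv_dft n = Matrix.mat n n (\<lambda>(j, k). 1 / of_nat n * exp (2 * of_real pi * \<i> / of_nat n) ^ (j * k))"

definition wave_number :: "nat \<Rightarrow> nat \<Rightarrow> int" where
  "wave_number n j = (if j < n div 2 then int j else if j = n div 2 then 0 else int j - int n)"

definition Om :: "(axis \<Rightarrow> nat) \<Rightarrow> (axis \<Rightarrow> real) \<Rightarrow> (axis \<Rightarrow> real) \<Rightarrow> axis \<Rightarrow> complex mat" where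
  "Om N L R w = on_axis N w
     (mat_diag (N w) (\<lambda>j. complex_of_real (nu L R w) * of_int (wave_number (N w) j)))"

definition Psi :: "(axis \<Rightarrow> nat) \<Rightarrow> (axis \<Rightarrow> real) \<Rightarrow> (axis \<Rightarrow> real) \<Rightarrow> real \<Rightarrow> complex mat" where
  "Psi N L R \<tau> = complex_of_real (\<tau>\<^sup>2) \<cdot>\<^sub>m
     (Om N L R AX * Om N L R AX + Om N L R AY * Om N L R AY + Om N L R AZ * Om N L R AZ)"

definition diag_apply :: "(complex \<Rightarrow> complex) \<Rightarrow> complex mat \<Rightarrow> complex mat" where
  "diag_apply f M = mat_diag (dim_row M) (\<lambda>i. f (M $$ (i, i)))"

definition A_mat :: "(axis \<Rightarrow> nat) \<Rightarrow> (axis \<Rightarrow> real) \<Rightarrow> (axis \<Rightarrow> real) \<Rightarrow> real \<Rightarrow> complex mat" where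
  "A_mat N L R \<tau> = diag_apply
     (\<lambda>p. if p = 0 then - 1 / 2 else (cosh (csqrt (- p)) - 1) / p) (Psi N L R \<tau>)"

definition B_mat :: "(axis \<Rightarrow> nat) \<Rightarrow> (axis \<Rightarrow> real) \<Rightarrow> (axis \<Rightarrow> real) \<Rightarrow> real \<Rightarrow> complex mat" where
  "B_mat N L R \<tau> = diag_apply
     (\<lambda>p. if p = 0 then 1 else sinh (csqrt (- p)) / csqrt (- p)) (Psi N L R \<tau>)"

definition c_diag ::
  "(axis \<Rightarrow> nat) \<Rightarrow> (axis \<Rightarrow> real) \<Rightarrow> (axis \<Rightarrow> real) \<Rightarrow> real \<Rightarrow> axis \<Rightarrow> axis \<Rightarrow> complex mat" where
  "c_diag N L R \<tau> v w = 1\<^sub>m (grid_size N) + complex_of_real (\<tau>\<^sup>2) \<cdot>\<^sub>m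
     ((Om N L R v * Om N L R v + Om N L R w * Om N L R w) * A_mat N L R \<tau>)"

definition c_off ::
  "(axis \<Rightarrow> nat) \<Rightarrow> (axis \<Rightarrow> real) \<Rightarrow> (axis \<Rightarrow> real) \<Rightarrow> real \<Rightarrow> axis \<Rightarrow> axis \<Rightarrow> complex mat" where
  "c_off N L R \<tau> v w = - complex_of_real (\<tau>\<^sup>2) \<cdot>\<^sub>m (Om N L R v * Om N L R w * A_mat N L R \<tau>)"

definition s_off ::
  "(axis \<Rightarrow> nat) \<Rightarrow> (axis \<Rightarrow> real) \<Rightarrow> (axis \<Rightarrow> real) \<Rightarrow> real \<Rightarrow> axis \<Rightarrow> complex mat" where
  "s_off N L R \<tau> w = (\<i> * complex_of_real \<tau>) \<cdot>\<^sub>m (Om N L R w * B_mat N L R \<tau>)"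

text \<open>
  \<open>c_mat N L R \<tau> v w\<close> and \<open>s_mat N L R \<tau> v w\<close> are the blocks in block row \<open>v\<close> and block column \<open>w\<close>.
\<close>

fun c_mat ::
  "(axis \<Rightarrow> nat) \<Rightarrow> (axis \<Rightarrow> real) \<Rightarrow> (axis \<Rightarrow> real) \<Rightarrow> real \<Rightarrow> axis \<Rightarrow> axis \<Rightarrow> complex mat" where
  "c_mat N L R \<tau> AX AX = c_diag N L R \<tau> AZ AY"
| "c_mat N L R \<tau> AX AY = c_off N L R \<tau> AY AX"
| "c_mat N L R \<tau> AX AZ = c_off N L R \<tau> AZ AX"
| "c_mat N L R \<tau> AY AX = c_off N L R \<tau> AY AX"
| "c_mat N L R \<tau> AY AY = c_diag N L R \<tau> AZ AX"
| "c_mat N L R \<tau> AY AZ = c_off N L R \<tau> AZ AY"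
| "c_mat N L R \<tau> AZ AX = c_off N L R \<tau> AZ AX"
| "c_mat N L R \<tau> AZ AY = c_off N L R \<tau> AZ AY"
| "c_mat N L R \<tau> AZ AZ = c_diag N L R \<tau> AY AX"

fun s_mat ::
  "(axis \<Rightarrow> nat) \<Rightarrow> (axis \<Rightarrow> real) \<Rightarrow> (axis \<Rightarrow> real) \<Rightarrow> real \<Rightarrow> axis \<Rightarrow> axis \<Rightarrow> complex mat" where
  "s_mat N L R \<tau> AX AX = 0\<^sub>m (grid_size N) (grid_size N)"
| "s_mat N L R \<tau> AX AY = - s_off N L R \<tau> AZ"
| "s_mat N L R \<tau> AX AZ = s_off N L R \<tau> AY"
| "s_mat N L R \<tau> AY AX = s_off N L R \<tau> AZ"
| "s_mat N L R \<tau> AY AY = 0\<^sub>m (grid_size N) (grid_size N)"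
| "s_mat N L R \<tau> AY AZ = - s_off N L R \<tau> AX"
| "s_mat N L R \<tau> AZ AX = - s_off N L R \<tau> AY"
| "s_mat N L R \<tau> AZ AY = s_off N L R \<tau> AX"
| "s_mat N L R \<tau> AZ AZ = 0\<^sub>m (grid_size N) (grid_size N)"

definition block_mult ::
  "(axis \<Rightarrow> axis \<Rightarrow> complex mat) \<Rightarrow> (axis \<Rightarrow> complex vec) \<Rightarrow> axis \<Rightarrow> complex vec" where
  "block_mult M V v = M v AX *\<^sub>v V AX + M v AY *\<^sub>v V AY + M v AZ *\<^sub>v V AZ"

section \<open>Fully discrete scheme\<close>

definition initial_hat ::
  "(axis \<Rightarrow> nat) \<Rightarrow> (axis \<Rightarrow> real) \<Rightarrow> (axis \<Rightarrow> real) \<Rightarrow> (axis \<Rightarrow> real \<times> real \<times> real \<Rightarrow> real)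
   \<Rightarrow> axis \<Rightarrow> complex vec" where
  "initial_hat N L R F0 w = kronecker3 (\<lambda>v. dft (N v)) *\<^sub>v sample N L R (F0 w)"

text \<open>
  In the next two definitions the scheme's equations for \<open>sqrt \<mu> H\<close> and \<open>sqrt \<epsilon> E\<close> in Fourier space
  are solved for \<open>H\<close> and \<open>E\<close>.
\<close>

definition H_hat ::
  "real \<Rightarrow> real \<Rightarrow> (axis \<Rightarrow> nat) \<Rightarrow> (axis \<Rightarrow> real) \<Rightarrow> (axis \<Rightarrow> real)
   \<Rightarrow> (axis \<Rightarrow> real \<times> real \<times> real \<Rightarrow> real) \<Rightarrow> (axis \<Rightarrow> real \<times> real \<times> real \<Rightarrow> real)
   \<Rightarrow> real \<Rightarrow> axis \<Rightarrow> complex vec" where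
  "H_hat \<epsilon> \<mu> N L R E0 H0 t w = complex_of_real (1 / sqrt \<mu>) \<cdot>\<^sub>v
     (complex_of_real (sqrt \<mu>) \<cdot>\<^sub>v block_mult (c_mat N L R (t / sqrt (\<mu> * \<epsilon>))) (initial_hat N L R H0) w
      - complex_of_real (sqrt \<epsilon>) \<cdot>\<^sub>v block_mult (s_mat N L R (t / sqrt (\<mu> * \<epsilon>))) (initial_hat N L R E0) w)"

definition E_hat ::
  "real \<Rightarrow> real \<Rightarrow> (axis \<Rightarrow> nat) \<Rightarrow> (axis \<Rightarrow> real) \<Rightarrow> (axis \<Rightarrow> real)
   \<Rightarrow> (axis \<Rightarrow> real \<times> real \<times> real \<Rightarrow> real) \<Rightarrow> (axis \<Rightarrow> real \<times> real \<times> real \<Rightarrow> real)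
   \<Rightarrow> real \<Rightarrow> axis \<Rightarrow> complex vec" where
  "E_hat \<epsilon> \<mu> N L R E0 H0 t w = complex_of_real (1 / sqrt \<epsilon>) \<cdot>\<^sub>v
     (complex_of_real (sqrt \<epsilon>) \<cdot>\<^sub>v block_mult (c_mat N L R (t / sqrt (\<mu> * \<epsilon>))) (initial_hat N L R E0) w
      + complex_of_real (sqrt \<mu>) \<cdot>\<^sub>v block_mult (s_mat N L R (t / sqrt (\<mu> * \<epsilon>))) (initial_hat N L R H0) w)"

definition H_scheme ::
  "real \<Rightarrow> real \<Rightarrow> (axis \<Rightarrow> nat) \<Rightarrow> (axis \<Rightarrow> real) \<Rightarrow> (axis \<Rightarrow> real)
   \<Rightarrow> (axis \<Rightarrow> real \<times> real \<times> real \<Rightarrow> real) \<Rightarrow> (axis \<Rightarrow> real \<times> real \<times> real \<Rightarrow> real)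
   \<Rightarrow> real \<Rightarrow> axis \<Rightarrow> complex vec" where
  "H_scheme \<epsilon> \<mu> N L R E0 H0 t w = kronecker3 (\<lambda>v. inv_dft (N v)) *\<^sub>v H_hat \<epsilon> \<mu> N L R E0 H0 t w"

definition E_scheme ::
  "real \<Rightarrow> real \<Rightarrow> (axis \<Rightarrow> nat) \<Rightarrow> (axis \<Rightarrow> real) \<Rightarrow> (axis \<Rightarrow> real)
   \<Rightarrow> (axis \<Rightarrow> real \<times> real \<times> real \<Rightarrow> real) \<Rightarrow> (axis \<Rightarrow> real \<times> real \<times> real \<Rightarrow> real)
   \<Rightarrow> real \<Rightarrow> axis \<Rightarrow> complex vec" where
  "E_scheme \<epsilon> \<mu> N L R E0 H0 t w = kronecker3 (\<lambda>v. inv_dft (N v)) *\<^sub>v E_hat \<epsilon> \<mu> N L R E0 H0 t w"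

section \<open>Energies\<close>

text \<open>
  The scheme is defined for times \<open>t \<ge> 0\<close>, so derivatives are taken within \<open>{0..}\<close>: two-sided at
  positive times and right-sided at time 0.
\<close>

definition time_differentiable :: "(real \<Rightarrow> axis \<Rightarrow> complex vec) \<Rightarrow> real \<Rightarrow> bool" where
  "time_differentiable F t \<longleftrightarrow>
     (\<forall>w. \<forall>i < dim_vec (F t w). (\<lambda>s. F s w $ i) differentiable (at t within {0..}))"

definition ddt :: "(real \<Rightarrow> axis \<Rightarrow> complex vec) \<Rightarrow> real \<Rightarrow> axis \<Rightarrow> complex vec" where
  "ddt F t w = Matrix.vec (dim_vec (F t w))
     (\<lambda>i. vector_derivative (\<lambda>s. F s w $ i) (at t within {0..}))"

text \<open>
  In the energies, \<open>E\<close> and \<open>H\<close> are the trajectories \<open>t \<mapsto> E\<^sup>t\<close> and \<open>t \<mapsto> H\<^sup>t\<close>, and \<open>D\<close> is the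
  differentiation matrix acting on each of the three components.  The values are complex because
  the inner product is.
\<close>

definition energy1 ::
  "real \<Rightarrow> real \<Rightarrow> (axis \<Rightarrow> nat) \<Rightarrow> (real \<Rightarrow> axis \<Rightarrow> complex vec) \<Rightarrow> (real \<Rightarrow> axis \<Rightarrow> complex vec)
   \<Rightarrow> real \<Rightarrow> complex" where
  "energy1 \<epsilon> \<mu> N E H t =
     complex_of_real (\<mu> / 2) * field_inner N (H t) (H t)
     + complex_of_real (\<epsilon> / 2) * field_inner N (E t) (E t)"

definition energy2 ::
  "real \<Rightarrow> real \<Rightarrow> (axis \<Rightarrow> nat) \<Rightarrow> (real \<Rightarrow> axis \<Rightarrow> complex vec) \<Rightarrow> (real \<Rightarrow> axis \<Rightarrow> complex vec)
   \<Rightarrow> real \<Rightarrow> complex" where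
  "energy2 \<epsilon> \<mu> N E H t =
     complex_of_real (\<mu> / 2) * field_inner N (ddt H t) (ddt H t)
     + complex_of_real (\<epsilon> / 2) * field_inner N (ddt E t) (ddt E t)"

definition energy3 ::
  "real \<Rightarrow> real \<Rightarrow> (axis \<Rightarrow> nat) \<Rightarrow> complex mat
   \<Rightarrow> (real \<Rightarrow> axis \<Rightarrow> complex vec) \<Rightarrow> (real \<Rightarrow> axis \<Rightarrow> complex vec) \<Rightarrow> real \<Rightarrow> complex" where
  "energy3 \<epsilon> \<mu> N D E H t =
     complex_of_real (\<mu> / 2) * (\<Sum>w\<in>{AX, AY, AZ}. grid_inner N (D *\<^sub>v H t w) (D *\<^sub>v H t w))
     + complex_of_real (\<epsilon> / 2) * (\<Sum>w\<in>{AX, AY, AZ}. grid_inner N (D *\<^sub>v E t w) (D *\<^sub>v E t w))"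

definition energy4 ::
  "real \<Rightarrow> real \<Rightarrow> (axis \<Rightarrow> nat) \<Rightarrow> complex mat
   \<Rightarrow> (real \<Rightarrow> axis \<Rightarrow> complex vec) \<Rightarrow> (real \<Rightarrow> axis \<Rightarrow> complex vec) \<Rightarrow> real \<Rightarrow> complex" where
  "energy4 \<epsilon> \<mu> N D E H t =
     complex_of_real (\<mu> / 2) * (\<Sum>w\<in>{AX, AY, AZ}. grid_inner N (D *\<^sub>v ddt H t w) (D *\<^sub>v ddt H t w))
     + complex_of_real (\<epsilon> / 2) * (\<Sum>w\<in>{AX, AY, AZ}. grid_inner N (D *\<^sub>v ddt E t w) (D *\<^sub>v ddt E t w))"

definition energy5 ::
  "real \<Rightarrow> real \<Rightarrow> (axis \<Rightarrow> nat) \<Rightarrow> complex mat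
   \<Rightarrow> (real \<Rightarrow> axis \<Rightarrow> complex vec) \<Rightarrow> (real \<Rightarrow> axis \<Rightarrow> complex vec) \<Rightarrow> real \<Rightarrow> complex" where
  "energy5 \<epsilon> \<mu> N D E H t =
     complex_of_real (\<mu> / 2) * (\<Sum>w\<in>{AX, AY, AZ}. grid_inner N (H t w) (D *\<^sub>v H t w))
     + complex_of_real (\<epsilon> / 2) * (\<Sum>w\<in>{AX, AY, AZ}. grid_inner N (E t w) (D *\<^sub>v E t w))"

definition energy6 ::
  "real \<Rightarrow> real \<Rightarrow> (axis \<Rightarrow> nat) \<Rightarrow> complex mat
   \<Rightarrow> (real \<Rightarrow> axis \<Rightarrow> complex vec) \<Rightarrow> (real \<Rightarrow> axis \<Rightarrow> complex vec) \<Rightarrow> real \<Rightarrow> complex" where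
  "energy6 \<epsilon> \<mu> N D E H t =
     complex_of_real (\<mu> / 2) * (\<Sum>w\<in>{AX, AY, AZ}. grid_inner N (ddt H t w) (D *\<^sub>v ddt H t w))
     + complex_of_real (\<epsilon> / 2) * (\<Sum>w\<in>{AX, AY, AZ}. grid_inner N (ddt E t w) (D *\<^sub>v ddt E t w))"

end

(*
  In Fourier space the scheme decouples into the modes of the grid.  For a mode with wave vector
  kappa, the matrix X = i [kappa]_x is Hermitian with X^3 = |kappa|^2 X, so c = cos (tau X) and
  s = sin (tau X); hence (sqrt mu H, sqrt eps E) is rotated, and mu |H|^2 + eps |E|^2 is conserved
  in every mode.  The time derivative obeys the same rotation with initial data
  (- X sqrt eps E0, X sqrt mu H0) / sqrt (mu eps).  The inverse DFT has orthogonal columns of equal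
  norm and, N being even, diagonalizes the circulant matrices D_k; so each of the six energies is a
  weighted sum over the modes of these conserved quantities.  The eigenvalues of D_k never have to
  be computed.
*)
theory Submission
  imports Defs
begin

section \<open>Kronecker products and the discrete Fourier transform\<close>

text \<open>An index below \<open>a * b\<close> is a pair of quotient and remainder by
  \<open>b\<close>; these index the two factors of a Kronecker product.\<close>

lemma sum_div_mod:
  fixes f g :: "nat \<Rightarrow> 'a::comm_semiring_0"
  shows "(\<Sum>k<a * b. f (k div b) * g (k mod b)) = (\<Sum>i<a. f i) * (\<Sum>j<b. g j)"
proof (cases "b = 0")
  case False
  have "(\<Sum>k<a * b. f (k div b) * g (k mod b))
      = (\<Sum>i<a. \<Sum>k = i * b..<i * b + b. f (k div b) * g (k mod b))"
    by (rule sum.nat_group[symmetric])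
  also have "\<dots> = (\<Sum>i<a. \<Sum>j<b. f i * g j)"
  proof (rule sum.cong[OF refl])
    fix i
    \<comment> \<open>The bounds are spelled as shifts of \<open>0\<close> and \<open>b\<close>, so
      that the shift rule matches.\<close>
    have "(\<Sum>k = 0 + i * b..<b + i * b. f (k div b) * g (k mod b))
        = (\<Sum>j = 0..<b. f ((j + i * b) div b) * g ((j + i * b) mod b))"
      by (rule sum.shift_bounds_nat_ivl)
    also have "\<dots> = (\<Sum>j<b. f i * g j)"
      using False by (intro sum.cong) auto
    finally show "(\<Sum>k = i * b..<i * b + b. f (k div b) * g (k mod b)) = (\<Sum>j<b. f i * g j)"
      by (simp add: add.commute)
  qed
  finally show ?thesis by (simp add: sum_product)
qed simp

text \<open>Splits a Kronecker delta on a product index into the deltas of the two factors.\<close>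

lemma nat_eq_iff_div_mod: "m = n \<longleftrightarrow> m div b = n div b \<and> m mod b = n mod (b::nat)"
  by (metis div_mult_mod_eq)

lemma kronecker_carrier [simp]:
  "A \<in> carrier_mat m n \<Longrightarrow> B \<in> carrier_mat p q \<Longrightarrow> kronecker A B \<in> carrier_mat (m * p) (n * q)"
  by (auto simp: kronecker_def)

text \<open>The mixed-product property: the sum over the inner index factors by
  \<open>sum_div_mod\<close>.\<close>

lemma kronecker_mult:
  assumes "A \<in> carrier_mat m n" "B \<in> carrier_mat p q" "C \<in> carrier_mat n k" "D \<in> carrier_mat q l"
  shows "kronecker A B * kronecker C D = kronecker (A * C) (B * D)"
proof (rule eq_matI)
  fix i j
  assume "i < dim_row (kronecker (A * C) (B * D))" "j < dim_col (kronecker (A * C) (B * D))"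
  then have ij: "i < m * p" "j < k * l" using assms by (auto simp: kronecker_def)
  then have p: "0 < p" "0 < l" by (auto intro: gr0I)
  then have idx: "i div p < m" "i mod p < p" "j div l < k" "j mod l < l"
    using ij by (auto simp: less_mult_imp_div_less)
  have "(kronecker A B * kronecker C D) $$ (i, j) =
      (\<Sum>t<n * q. (A $$ (i div p, t div q) * C $$ (t div q, j div l))
                * (B $$ (i mod p, t mod q) * D $$ (t mod q, j mod l)))"
    using ij assms by (auto simp: scalar_prod_def kronecker_def lessThan_atLeast0 intro!: sum.cong)
  also have "\<dots> = (A * C) $$ (i div p, j div l) * (B * D) $$ (i mod p, j mod l)"
    using assms idx by (subst sum_div_mod) (simp add: scalar_prod_def lessThan_atLeast0)
  finally show "(kronecker A B * kronecker C D) $$ (i, j) = kronecker (A * C) (B * D) $$ (i, j)"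
    using ij assms by (auto simp: kronecker_def)
qed (use assms in \<open>auto simp: kronecker_def\<close>)

lemma kronecker_mat_diag:
  "kronecker (mat_diag m f) (mat_diag n g) = mat_diag (m * n) (\<lambda>i. f (i div n) * g (i mod n))"
proof (rule eq_matI)
  fix i j
  assume "i < dim_row (mat_diag (m * n) (\<lambda>i. f (i div n) * g (i mod n)))"
    and "j < dim_col (mat_diag (m * n) (\<lambda>i. f (i div n) * g (i mod n)))"
  then have ij: "i < m * n" "j < m * n" by (auto simp: mat_diag_def)
  then have "0 < n" by (auto intro: gr0I)
  then have "i div n < m" "i mod n < n" "j div n < m" "j mod n < n"
    using ij by (auto simp: less_mult_imp_div_less)
  then show "kronecker (mat_diag m f) (mat_diag n g) $$ (i, j)
      = mat_diag (m * n) (\<lambda>i. f (i div n) * g (i mod n)) $$ (i, j)"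
    using ij nat_eq_iff_div_mod[of i j n] by (auto simp: kronecker_def mat_diag_def)
qed (auto simp: kronecker_def mat_diag_def)

lemma kronecker3_carrier:
  assumes "\<And>w. M w \<in> carrier_mat (N w) (N w)"
  shows "kronecker3 M \<in> carrier_mat (grid_size N) (grid_size N)"
  using kronecker_carrier[OF assms[of AZ] kronecker_carrier[OF assms[of AY] assms[of AX]]]
  by (simp add: kronecker3_def grid_size_def ac_simps)

lemma kronecker3_mult:
  assumes "\<And>w. P w \<in> carrier_mat (N w) (N w)" "\<And>w. Q w \<in> carrier_mat (N w) (N w)"
  shows "kronecker3 P * kronecker3 Q = kronecker3 (\<lambda>w. P w * Q w)"
  unfolding kronecker3_def
  by (subst kronecker_mult[OF assms(1) kronecker_carrier[OF assms(1) assms(1)]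
        assms(2) kronecker_carrier[OF assms(2) assms(2)]])
     (simp add: kronecker_mult[OF assms(1) assms(1) assms(2) assms(2)])

text \<open>The coordinate of grid position \<open>m\<close> along an axis. The z index runs
  slowest, so for \<open>m < grid_size N\<close> the quotient is below \<open>N AZ\<close> without
  reduction.\<close>

fun axis_index :: "(axis \<Rightarrow> nat) \<Rightarrow> axis \<Rightarrow> nat \<Rightarrow> nat" where
  "axis_index N AX m = m mod N AX"
| "axis_index N AY m = m div N AX mod N AY"
| "axis_index N AZ m = m div (N AX * N AY)"

lemma on_axis_mat_diag:
  "on_axis N w (mat_diag (N w) f) = mat_diag (grid_size N) (\<lambda>m. f (axis_index N w m))"
proof (cases "N AX = 0")
  \<comment> \<open>The grid is empty, so both sides have no entries. Otherwise \<open>N AX\<close>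
    can be cancelled when the y index is extracted.\<close>
  case True
  then show ?thesis
    by (cases w) (auto simp: on_axis_def kronecker3_def kronecker_def mat_diag_def grid_size_def)
next
  case False
  then show ?thesis
    by (cases w)
      (simp_all add: on_axis_def kronecker3_def kronecker_mat_diag grid_size_def mult.commute
        div_mult2_eq mod_mult2_eq flip: mat_diag_one)
qed

section \<open>Scaled unitary matrices and Parseval's identity\<close>

definition orthogonal_columns :: "nat \<Rightarrow> complex \<Rightarrow> complex mat \<Rightarrow> bool" where
  "orthogonal_columns n c U \<longleftrightarrow> U \<in> carrier_mat n n \<and>
     (\<forall>j<n. \<forall>k<n. (\<Sum>i<n. U $$ (i, j) * cnj (U $$ (i, k))) = (if j = k then c else 0))"

text \<open>The inner product of two columns of a Kronecker product is the product of the inner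
  products of the factors' columns.\<close>

lemma orthogonal_columns_kronecker:
  assumes "orthogonal_columns m c U" "orthogonal_columns n d V"
  shows "orthogonal_columns (m * n) (c * d) (kronecker U V)"
  unfolding orthogonal_columns_def
proof (intro conjI allI impI)
  have U: "U \<in> carrier_mat m m" and V: "V \<in> carrier_mat n n"
    using assms by (auto simp: orthogonal_columns_def)
  then show "kronecker U V \<in> carrier_mat (m * n) (m * n)" by simp
  fix j k assume jk: "j < m * n" "k < m * n"
  then have "0 < n" by (auto intro: gr0I)
  then have idx: "j div n < m" "j mod n < n" "k div n < m" "k mod n < n"
    using jk by (auto simp: less_mult_imp_div_less)
  have "(\<Sum>i<m * n. kronecker U V $$ (i, j) * cnj (kronecker U V $$ (i, k)))
      = (\<Sum>i<m * n. (U $$ (i div n, j div n) * cnj (U $$ (i div n, k div n)))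
                   * (V $$ (i mod n, j mod n) * cnj (V $$ (i mod n, k mod n))))"
    using U V jk by (intro sum.cong) (auto simp: kronecker_def)
  also have "\<dots> = (if j = k then c * d else 0)"
    using assms idx nat_eq_iff_div_mod[of j k n]
    by (subst sum_div_mod) (auto simp: orthogonal_columns_def)
  finally show "(\<Sum>i<m * n. kronecker U V $$ (i, j) * cnj (kronecker U V $$ (i, k)))
      = (if j = k then c * d else 0)" .
qed

text \<open>Parseval's identity with the factor \<open>c\<close>.\<close>

lemma orthogonal_columns_cscalar_prod:
  assumes U: "orthogonal_columns n c U" and a: "dim_vec a = n" "dim_vec b = n"
  shows "(U *\<^sub>v a) \<bullet>c (U *\<^sub>v b) = c * (\<Sum>m<n. a $ m * cnj (b $ m))"
proof -
  have C: "U \<in> carrier_mat n n" using U by (simp add: orthogonal_columns_def)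
  have "(U *\<^sub>v a) \<bullet>c (U *\<^sub>v b)
     = (\<Sum>i<n. (\<Sum>j<n. U $$ (i, j) * a $ j) * cnj (\<Sum>k<n. U $$ (i, k) * b $ k))"
    using C a by (simp add: scalar_prod_def lessThan_atLeast0)
  also have "\<dots> = (\<Sum>i<n. \<Sum>j<n. \<Sum>k<n. (a $ j * cnj (b $ k)) * (U $$ (i, j) * cnj (U $$ (i, k))))"
    by (simp add: sum_product ac_simps)
  \<comment> \<open>Two swaps move the row index innermost, where orthogonality of the columns
    evaluates its sum.\<close>
  also have "\<dots> = (\<Sum>j<n. \<Sum>i<n. \<Sum>k<n. (a $ j * cnj (b $ k)) * (U $$ (i, j) * cnj (U $$ (i, k))))"
    by (rule sum.swap)
  also have "\<dots> = (\<Sum>j<n. \<Sum>k<n. \<Sum>i<n. (a $ j * cnj (b $ k)) * (U $$ (i, j) * cnj (U $$ (i, k))))"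
    by (intro sum.cong refl sum.swap)
  also have "\<dots> = (\<Sum>j<n. \<Sum>k<n. (a $ j * cnj (b $ k)) * (if j = k then c else 0))"
    using U by (intro sum.cong refl) (auto simp: orthogonal_columns_def simp flip: sum_distrib_left)
  also have "\<dots> = c * (\<Sum>m<n. a $ m * cnj (b $ m))"
    by (simp add: sum_distrib_left mult_ac if_distrib[of "\<lambda>x. _ * x"] cong: if_cong)
  finally show ?thesis .
qed

lemma inv_dft_carrier [simp]: "inv_dft n \<in> carrier_mat n n"
  by (simp add: inv_dft_def)

lemma root_of_unity_cis: "exp (2 * of_real pi * \<i> / of_nat n) = cis (2 * pi / real n)"
  by (simp add: cis_conv_exp mult_ac)

lemma inv_dft_index:
  "i < n \<Longrightarrow> j < n \<Longrightarrow> inv_dft n $$ (i, j) = cis (2 * pi / real n) ^ (i * j) / of_nat n"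
  by (simp add: inv_dft_def root_of_unity_cis)

lemma cis_root_pow_n: "0 < n \<Longrightarrow> cis (2 * pi / real n) ^ n = 1"
  using DeMoivre[of "2 * pi / real n" n] by simp

text \<open>The inner product of columns j and k is a geometric sum over powers of an n-th root of
  unity that equals 1 only for j = k; it is scaled by 1/n^2.\<close>

lemma orthogonal_columns_inv_dft: "orthogonal_columns n (1 / of_nat n) (inv_dft n)"
  unfolding orthogonal_columns_def
proof (intro conjI allI impI)
  fix j k assume jk: "j < n" "k < n"
  then have n: "0 < n" by simp
  define \<omega> where "\<omega> = cis (2 * pi / real n)"
  \<comment> \<open>This is \<omega>^(j-k), written with a conjugate to keep the exponents
    natural.\<close>
  define z where "z = \<omega> ^ j * cnj (\<omega> ^ k)"
  have wn: "\<omega> ^ n = 1" using n by (simp add: \<omega>_def cis_root_pow_n)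
  have unit: "\<omega> ^ m * cnj (\<omega> ^ m) = 1" for m
    using complex_norm_square[of "\<omega> ^ m"] by (simp add: \<omega>_def norm_power)
  have "z ^ n = 1"
    by (simp add: z_def power_mult_distrib wn flip: complex_cnj_power power_mult)
       (simp add: mult.commute[of _ n] power_mult wn)
  have pow: "\<omega> ^ m = cis (2 * pi * real m / real n)" for m
    by (simp add: \<omega>_def DeMoivre mult_ac)
  have z1: "z = 1 \<longleftrightarrow> j = k"
  proof
    assume "z = 1"
    have "\<omega> ^ j = \<omega> ^ j * (\<omega> ^ k * cnj (\<omega> ^ k))" by (simp only: unit mult_1_right)
    also have "\<dots> = z * \<omega> ^ k" by (simp add: z_def)
    finally have "\<omega> ^ j = \<omega> ^ k" using \<open>z = 1\<close> by simp
    \<comment> \<open>Distinct exponents below \<open>n\<close> give distinct n-th roots of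
      unity.\<close>
    then show "j = k"
      using bij_betw_imp_inj_on[OF bij_betw_roots_unity[OF n]] jk
      by (auto simp: pow inj_on_def)
  qed (simp only: z_def unit)
  have sum0: "(\<Sum>i<n. z ^ i) = (if j = k then of_nat n else 0)"
    using z1 \<open>z ^ n = 1\<close> by (auto simp: sum_gp_strict)
  have "(\<Sum>i<n. inv_dft n $$ (i, j) * cnj (inv_dft n $$ (i, k))) = (\<Sum>i<n. z ^ i / of_nat n ^ 2)"
    using jk by (intro sum.cong refl)
      (simp add: inv_dft_index z_def \<omega>_def power_mult_distrib power2_eq_square
        mult.commute flip: power_mult complex_cnj_power)
  also have "\<dots> = (if j = k then 1 / of_nat n else 0)"
    by (simp add: sum0 power2_eq_square flip: sum_divide_distrib)
  finally show "(\<Sum>i<n. inv_dft n $$ (i, j) * cnj (inv_dft n $$ (i, k)))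
      = (if j = k then 1 / of_nat n else 0)" .
qed simp

lemma diff_mat_carrier [simp]: "diff_mat N L R w \<in> carrier_mat (N w) (N w)"
  by (simp add: diff_mat_def)

section \<open>Diagonalization of circulant matrices\<close>

text \<open>The columns of the inverse DFT are the characters of the cyclic group Z/n. A cyclic
  shift only multiplies them by a root of unity, so they are eigenvectors of every circulant
  matrix.\<close>

lemma circulant_mult_inv_dft:
  assumes A: "A \<in> carrier_mat n n"
    and circ: "\<And>j d. j < n \<Longrightarrow> d < n \<Longrightarrow> A $$ (j, (j + d) mod n) = g d"
  shows "A * inv_dft n
      = inv_dft n * mat_diag n (\<lambda>k. \<Sum>d<n. g d * cis (2 * pi / real n) ^ (d * k))"
proof (rule eq_matI)
  let ?\<omega> = "cis (2 * pi / real n)"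
  let ?\<Lambda> = "mat_diag n (\<lambda>k. \<Sum>d<n. g d * ?\<omega> ^ (d * k))"
  fix j k assume "j < dim_row (inv_dft n * ?\<Lambda>)" "k < dim_col (inv_dft n * ?\<Lambda>)"
  then have jk: "j < n" "k < n" by (auto simp: inv_dft_def mat_diag_def)
  then have n: "0 < n" by simp
  have pow_mod: "?\<omega> ^ (m mod n) = ?\<omega> ^ m" for m
  proof -
    have "?\<omega> ^ m = ?\<omega> ^ (n * (m div n) + m mod n)" by simp
    also have "\<dots> = ?\<omega> ^ (m mod n)"
      using cis_root_pow_n[OF n] by (simp only: power_add power_mult power_one mult_1_left)
    finally show ?thesis by simp
  qed
  have "(A * inv_dft n) $$ (j, k) = (\<Sum>l<n. A $$ (j, l) * (?\<omega> ^ (l * k) / of_nat n))"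
    using A jk by (simp add: scalar_prod_def inv_dft_index lessThan_atLeast0 inv_dft_def root_of_unity_cis)
  \<comment> \<open>The column index becomes an offset d = l - j modulo \<open>n\<close>; adding
    \<open>n - j\<close> avoids truncated subtraction.\<close>
  also have "\<dots> = (\<Sum>d<n. A $$ (j, (j + d) mod n) * (?\<omega> ^ ((j + d) mod n * k) / of_nat n))"
  proof (rule sum.reindex_bij_witness[of _ "\<lambda>d. (j + d) mod n" "\<lambda>l. (l + (n - j)) mod n"])
    fix d assume "d \<in> {..<n}"
    moreover have "j + d + (n - j) = d + n" using jk by simp
    ultimately show "((j + d) mod n + (n - j)) mod n = d"
      by (simp only: mod_add_left_eq) simp
  next
    fix l assume "l \<in> {..<n}"
    moreover have "j + (l + (n - j)) = l + n" using jk by simp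
    ultimately show l: "(j + (l + (n - j)) mod n) mod n = l"
      by (simp only: mod_add_right_eq) simp
    show "A $$ (j, (j + (l + (n - j)) mod n) mod n)
        * (?\<omega> ^ ((j + (l + (n - j)) mod n) mod n * k) / of_nat n)
      = A $$ (j, l) * (?\<omega> ^ (l * k) / of_nat n)"
      by (simp only: l)
  qed (use n in auto)
  also have "\<dots> = (\<Sum>d<n. ?\<omega> ^ (j * k) / of_nat n * (g d * ?\<omega> ^ (d * k)))"
    using jk by (intro sum.cong refl) (simp add: circ power_mult pow_mod power_add power_mult_distrib)
  also have "\<dots> = (inv_dft n * ?\<Lambda>) $$ (j, k)"
    using jk by (simp add: mat_diag_mult_right[OF inv_dft_carrier] inv_dft_index sum_distrib_left)
  finally show "(A * inv_dft n) $$ (j, k) = (inv_dft n * ?\<Lambda>) $$ (j, k)" .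
qed (use A in \<open>auto simp: inv_dft_def mat_diag_def\<close>)

text \<open>On equispaced nodes the cotangent is taken at \<pi>(j-l)/n. It has period \<pi>, and for
  even n the sign has period n in l.\<close>

lemma diff_mat_circulant:
  assumes "0 < N w" "even (N w)" "L w < R w" "j < N w" "d < N w"
  shows "diff_mat N L R w $$ (j, (j + d) mod N w) = diff_mat N L R w $$ (0, d)"
proof -
  define n where "n = N w"
  have n: "0 < n" "even n" "j < n" "d < n" using assms by (auto simp: n_def)
  have node: "nu L R w * (node N L R w i - node N L R w l) / 2
      = pi * (real i - real l) / real n" for i l
    using assms(3) n(1) by (simp add: nu_def node_def n_def field_simps)
  have entry: "diff_mat N L R w $$ (i, l) = (if i = l then 0 else complex_of_real
      (1 / 2 * nu L R w * (-1) ^ (i + l) * cot (pi * (real i - real l) / real n)))"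
    if "i < n" "l < n" for i l
    using that node[of i l] by (simp add: diff_mat_def n_def)
  show ?thesis
  proof (cases "j + d < n")
    case True
    then show ?thesis using n by (simp add: entry power_add flip: n_def)
  next
    \<comment> \<open>The column index wraps around: the argument gains \<pi>, and the exponent 2j +
      d - n has the parity of d.\<close>
    case False
    then have d: "0 < d" "(j + d) mod n = j + d - n" "real (j + d - n) = real j + real d - real n"
      using n by (auto simp: mod_if)
    have "pi * (real j - (real j + real d - real n)) / real n = pi * (- real d) / real n + pi"
      using n by (simp add: field_simps)
    then have cot: "cot (pi * (real j - real (j + d - n)) / real n) = cot (pi * (- real d) / real n)"
      using d by (simp add: cot_def)
    have sgn: "(- 1 :: real) ^ (j + (j + d - n)) = (- 1) ^ d"
      using n False by (auto simp: minus_one_power_iff)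
    show ?thesis
      using n d(1) False unfolding n_def[symmetric] d(2)
      by (simp only: entry cot sgn) simp
  qed
qed

text \<open>The mixed-product property reduces this to one direction, where the differentiation
  matrix is circulant; in the other two the factor is an identity.\<close>

lemma grid_diff_mult_kronecker3_inv_dft:
  assumes "\<And>w. L w < R w" "\<And>w. 0 < N w \<and> even (N w)"
  shows "\<exists>\<sigma>. grid_diff N L R k * kronecker3 (\<lambda>v. inv_dft (N v))
    = kronecker3 (\<lambda>v. inv_dft (N v)) * mat_diag (grid_size N) \<sigma>"
proof -
  let ?F = "\<lambda>v. inv_dft (N v)" and ?I = "\<lambda>v. 1\<^sub>m (N v) :: complex mat"
  obtain l where l: "diff_mat N L R k * ?F k = ?F k * mat_diag (N k) l"
    using circulant_mult_inv_dft[OF diff_mat_carrier diff_mat_circulant[of N k L R]] assms by blast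
  have "grid_diff N L R k * kronecker3 ?F = kronecker3 (\<lambda>v. (?I(k := diff_mat N L R k)) v * ?F v)"
    unfolding grid_diff_def on_axis_def by (rule kronecker3_mult) auto
  also have "\<dots> = kronecker3 (\<lambda>v. ?F v * (?I(k := mat_diag (N k) l)) v)"
    using l by (intro arg_cong[of _ _ kronecker3] ext)
      (auto simp: left_mult_one_mat[OF inv_dft_carrier] right_mult_one_mat[OF inv_dft_carrier])
  also have "\<dots> = kronecker3 ?F * on_axis N k (mat_diag (N k) l)"
    unfolding on_axis_def by (rule kronecker3_mult[symmetric]) auto
  finally show ?thesis unfolding on_axis_mat_diag by blast
qed

section \<open>Rotation of a single Fourier mode\<close>

definition inner3 :: "(axis \<Rightarrow> complex) \<Rightarrow> (axis \<Rightarrow> complex) \<Rightarrow> complex" where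
  "inner3 u v = (\<Sum>w\<in>{AX, AY, AZ}. u w * cnj (v w))"

text \<open>The map u -> i \<kappa> x u, the Fourier symbol of the curl.\<close>

fun curl_symbol :: "(axis \<Rightarrow> real) \<Rightarrow> (axis \<Rightarrow> complex) \<Rightarrow> axis \<Rightarrow> complex" where
  "curl_symbol \<kappa> u AX = \<i> * (\<kappa> AY * u AZ - \<kappa> AZ * u AY)"
| "curl_symbol \<kappa> u AY = \<i> * (\<kappa> AZ * u AX - \<kappa> AX * u AZ)"
| "curl_symbol \<kappa> u AZ = \<i> * (\<kappa> AX * u AY - \<kappa> AY * u AX)"

definition norm_sq3 :: "(axis \<Rightarrow> real) \<Rightarrow> real" where
  "norm_sq3 \<kappa> = (\<kappa> AX)\<^sup>2 + (\<kappa> AY)\<^sup>2 + (\<kappa> AZ)\<^sup>2"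

text \<open>With cos (\<tau> X) = 1 + a X^2 and sin (\<tau> X) = b X, \<open>rot_H\<close> and
  \<open>rot_E\<close> are the two components of the rotation of (u, v).\<close>

definition rot_H ::
  "(axis \<Rightarrow> real) \<Rightarrow> real \<Rightarrow> real \<Rightarrow> (axis \<Rightarrow> complex) \<Rightarrow> (axis \<Rightarrow> complex) \<Rightarrow> axis \<Rightarrow> complex" where
  "rot_H \<kappa> a b u v w = u w + a * curl_symbol \<kappa> (curl_symbol \<kappa> u) w - b * curl_symbol \<kappa> v w"

definition rot_E ::
  "(axis \<Rightarrow> real) \<Rightarrow> real \<Rightarrow> real \<Rightarrow> (axis \<Rightarrow> complex) \<Rightarrow> (axis \<Rightarrow> complex) \<Rightarrow> axis \<Rightarrow> complex" where
  "rot_E \<kappa> a b u v w = v w + a * curl_symbol \<kappa> (curl_symbol \<kappa> v) w + b * curl_symbol \<kappa> u w"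

text \<open>The matrix of a cross product with a real vector is antisymmetric; the factor i makes it
  Hermitian.\<close>

lemma curl_symbol_hermitian: "inner3 (curl_symbol \<kappa> u) v = inner3 u (curl_symbol \<kappa> v)"
  by (simp add: inner3_def algebra_simps)

text \<open>X u is orthogonal to \<kappa>, and X^2 acts on the orthogonal complement of \<kappa> as
  |\<kappa>|^2.\<close>

lemma curl_symbol_cube:
  "curl_symbol \<kappa> (curl_symbol \<kappa> (curl_symbol \<kappa> u)) w = norm_sq3 \<kappa> * curl_symbol \<kappa> u w"
  by (cases w) (simp_all add: norm_sq3_def algebra_simps power2_eq_square)

lemma curl_symbol_scale: "curl_symbol \<kappa> (\<lambda>w. c * u w) = (\<lambda>w. c * curl_symbol \<kappa> u w)"
proof
  fix w show "curl_symbol \<kappa> (\<lambda>w. c * u w) w = c * curl_symbol \<kappa> u w"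
    by (cases w) (simp_all add: algebra_simps)
qed

text \<open>The hypothesis is cos^2 + sin^2 = 1: by X^3 = |\<kappa>|^2 X, its left side is the
  coefficient of X^2 in (1 + a X^2)^2 + (b X)^2 - 1. The mixed terms of the two components
  cancel.\<close>

lemma rot_energy:
  assumes ab: "2 * a + a\<^sup>2 * norm_sq3 \<kappa> + b\<^sup>2 = 0"
  shows "inner3 (rot_H \<kappa> a b u v) (rot_H \<kappa> a b u v) + inner3 (rot_E \<kappa> a b u v) (rot_E \<kappa> a b u v)
    = inner3 u u + inner3 v v"
proof -
  let ?X = "curl_symbol \<kappa>"
  let ?r = "complex_of_real (norm_sq3 \<kappa>)"
  \<comment> \<open>Used from left to right, this collects all powers of X in the first argument,
    where \<open>cube\<close> reduces them.\<close>
  have herm: "inner3 p (?X q) = inner3 (?X p) q" for p q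
    by (simp add: curl_symbol_hermitian)
  have cube: "inner3 (?X (?X (?X p))) q = ?r * inner3 (?X p) q" for p q
    by (simp add: inner3_def curl_symbol_cube algebra_simps)
  have rel: "2 * complex_of_real a + (complex_of_real a)\<^sup>2 * ?r + (complex_of_real b)\<^sup>2 = 0"
    using arg_cong[OF ab, of complex_of_real] by simp
  have expand_H: "inner3 (rot_H \<kappa> a b u v) (rot_H \<kappa> a b u v) = inner3 u u
      + a * inner3 u (?X (?X u)) + a * inner3 (?X (?X u)) u
      + a\<^sup>2 * inner3 (?X (?X u)) (?X (?X u)) + b\<^sup>2 * inner3 (?X v) (?X v)
      - b * inner3 u (?X v) - b * inner3 (?X v) u
      - a * b * inner3 (?X (?X u)) (?X v) - a * b * inner3 (?X v) (?X (?X u))"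
    by (simp add: inner3_def rot_H_def algebra_simps power2_eq_square del: curl_symbol.simps)
  have expand_E: "inner3 (rot_E \<kappa> a b u v) (rot_E \<kappa> a b u v) = inner3 v v
      + a * inner3 v (?X (?X v)) + a * inner3 (?X (?X v)) v
      + a\<^sup>2 * inner3 (?X (?X v)) (?X (?X v)) + b\<^sup>2 * inner3 (?X u) (?X u)
      + b * inner3 v (?X u) + b * inner3 (?X u) v
      + a * b * inner3 (?X (?X v)) (?X u) + a * b * inner3 (?X u) (?X (?X v))"
    by (simp add: inner3_def rot_E_def algebra_simps power2_eq_square del: curl_symbol.simps)
  have "inner3 (rot_H \<kappa> a b u v) (rot_H \<kappa> a b u v) + inner3 (rot_E \<kappa> a b u v) (rot_E \<kappa> a b u v)
    = inner3 u u + inner3 v v + (2 * complex_of_real a + (complex_of_real a)\<^sup>2 * ?r + (complex_of_real b)\<^sup>2)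
      * (inner3 (?X (?X u)) u + inner3 (?X (?X v)) v)"
    unfolding expand_H expand_E herm cube by (simp add: algebra_simps)
  then show ?thesis by (simp only: rel) simp
qed

text \<open>
  If \<open>X\<close> is the symbol of the curl for a wave vector of length \<open>r\<close>, then
  \<open>cos (\<tau> X) = 1 + cos_quot r \<tau> X\<^sup>2\<close> and \<open>sin (\<tau> X) = sin_quot r \<tau> X\<close>; at \<open>r = 0\<close> the values are
  the limits, so \<open>cos_quot\<close> and \<open>sin_quot\<close> are the diagonal entries of \<open>\<tau>\<^sup>2 A\<close> and \<open>\<tau> B\<close>.
\<close>

definition cos_quot :: "real \<Rightarrow> real \<Rightarrow> real" where
  "cos_quot r \<tau> = (if r = 0 then - \<tau>\<^sup>2 / 2 else (cos (r * \<tau>) - 1) / r\<^sup>2)"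

definition sin_quot :: "real \<Rightarrow> real \<Rightarrow> real" where
  "sin_quot r \<tau> = (if r = 0 then \<tau> else sin (r * \<tau>) / r)"

text \<open>Supplies the hypothesis of \<open>rot_energy\<close>: cos^2 + sin^2 = 1 divided by r^2,
  with its limit at r = 0.\<close>

lemma cos_sin_quot_rel: "2 * cos_quot r \<tau> + (cos_quot r \<tau>)\<^sup>2 * r\<^sup>2 + (sin_quot r \<tau>)\<^sup>2 = 0"
proof (cases "r = 0")
  case False
  then have "2 * cos_quot r \<tau> + (cos_quot r \<tau>)\<^sup>2 * r\<^sup>2 + (sin_quot r \<tau>)\<^sup>2
      = (2 * (cos (r * \<tau>) - 1) + (cos (r * \<tau>) - 1)\<^sup>2 + (sin (r * \<tau>))\<^sup>2) / r\<^sup>2"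
    using False
    by (simp add: cos_quot_def sin_quot_def add_divide_distrib power_divide power2_eq_square)
  also have "\<dots> = 0" by (simp add: sin_squared_eq power2_diff)
  finally show ?thesis .
qed (simp add: cos_quot_def sin_quot_def)

text \<open>The X^2 coefficient of (cos (\<tau> X))' = - X sin (\<tau> X).\<close>

lemma cos_quot_deriv: "(cos_quot r has_real_derivative - sin_quot r \<tau>) (at \<tau> within S)"
proof (cases "r = 0")
  case True
  then show ?thesis unfolding cos_quot_def[abs_def] sin_quot_def
    by (auto intro!: derivative_eq_intros)
next
  case False
  then show ?thesis unfolding cos_quot_def[abs_def] sin_quot_def
    by (auto intro!: derivative_eq_intros simp: power2_eq_square)
qed

text \<open>The X coefficient of (sin (\<tau> X))' = X cos (\<tau> X), with X^3 replaced by r^2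
  X.\<close>

lemma sin_quot_deriv:
  "(sin_quot r has_real_derivative 1 + r\<^sup>2 * cos_quot r \<tau>) (at \<tau> within S)"
proof (cases "r = 0")
  case True
  then show ?thesis unfolding sin_quot_def[abs_def] cos_quot_def
    by (auto intro!: derivative_eq_intros)
next
  case False
  then show ?thesis unfolding sin_quot_def[abs_def] cos_quot_def
    by (auto intro!: derivative_eq_intros simp: power2_eq_square)
qed

text \<open>The principal root produces the absolute value; it disappears later because cosh z and
  sinh z / z are even.\<close>

lemma csqrt_minus_square: "csqrt (- complex_of_real (x\<^sup>2)) = \<i> * of_real \<bar>x\<bar>"
  using csqrt_of_real_nonpos[of "of_real (- (x\<^sup>2))"] by simp

lemma exp_i_real: "exp (\<i> * of_real x) = cis x" "exp (- (\<i> * of_real x)) = cis (- x)"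
  by (simp_all add: cis_conv_exp)

lemma cosh_csqrt: "cosh (csqrt (- complex_of_real (x\<^sup>2))) = of_real (cos x)"
  by (simp only: csqrt_minus_square)
     (simp add: cosh_field_def exp_i_real abs_if complex_eq_iff)

lemma sinh_csqrt:
  assumes "x \<noteq> 0"
  shows "sinh (csqrt (- complex_of_real (x\<^sup>2))) / csqrt (- complex_of_real (x\<^sup>2)) = of_real (sin x / x)"
proof -
  have "sinh (\<i> * of_real y) = \<i> * of_real (sin y)" for y
    by (simp add: sinh_field_def exp_i_real complex_eq_iff)
  then show ?thesis unfolding csqrt_minus_square using assms by (simp add: abs_if)
qed

section \<open>Diagonal form of the matrices of the scheme\<close>

definition wave_vec ::
  "(axis \<Rightarrow> nat) \<Rightarrow> (axis \<Rightarrow> real) \<Rightarrow> (axis \<Rightarrow> real) \<Rightarrow> nat \<Rightarrow> axis \<Rightarrow> real" where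
  "wave_vec N L R m w = nu L R w * of_int (wave_number (N w) (axis_index N w m))"

definition wave_norm :: "(axis \<Rightarrow> nat) \<Rightarrow> (axis \<Rightarrow> real) \<Rightarrow> (axis \<Rightarrow> real) \<Rightarrow> nat \<Rightarrow> real" where
  "wave_norm N L R m = sqrt (norm_sq3 (wave_vec N L R m))"

lemma wave_norm_sq: "(wave_norm N L R m)\<^sup>2 = norm_sq3 (wave_vec N L R m)"
  by (simp add: wave_norm_def norm_sq3_def)

lemma Om_eq: "Om N L R w = mat_diag (grid_size N) (\<lambda>m. complex_of_real (wave_vec N L R m w))"
  by (simp add: Om_def on_axis_mat_diag wave_vec_def)

lemma mat_diag_add: "mat_diag n f + mat_diag n g = mat_diag n (\<lambda>i. f i + (g i :: complex))"
  by (auto simp: mat_diag_def)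

lemma mat_diag_smult: "c \<cdot>\<^sub>m mat_diag n f = mat_diag n (\<lambda>i. c * (f i :: complex))"
  by (auto simp: mat_diag_def)

lemma mat_diag_uminus: "- mat_diag n f = mat_diag n (\<lambda>i. - (f i :: complex))"
  by (auto simp: mat_diag_def)

lemma zero_mat_diag: "0\<^sub>m n n = mat_diag n (\<lambda>_. 0 :: complex)"
  by (auto simp: mat_diag_def)

lemma one_mat_diag: "1\<^sub>m n = mat_diag n (\<lambda>_. 1 :: complex)"
  by simp

text \<open>The entries are displayed as real squares so that the formulas for \<open>csqrt\<close>
  of a negated square apply.\<close>

lemma Psi_eq: "Psi N L R \<tau>
    = mat_diag (grid_size N) (\<lambda>m. complex_of_real ((wave_norm N L R m * \<tau>)\<^sup>2))"
proof -
  have "complex_of_real ((wave_norm N L R m * \<tau>)\<^sup>2) = complex_of_real (\<tau>\<^sup>2)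
    * (wave_vec N L R m AX * wave_vec N L R m AX + wave_vec N L R m AY * wave_vec N L R m AY
      + wave_vec N L R m AZ * wave_vec N L R m AZ)" for m
    unfolding power_mult_distrib wave_norm_sq norm_sq3_def by (simp add: power2_eq_square)
  then show ?thesis
    by (simp only: Psi_def Om_eq mat_diag_diag mat_diag_add mat_diag_smult) simp
qed

lemma diag_apply_mat_diag: "diag_apply f (mat_diag n g) = mat_diag n (\<lambda>m. f (g m))"
  by (auto simp: diag_apply_def mat_diag_def)

text \<open>The value -1/2 by continuity enters when r = 0 or \<tau> = 0: it gives -\<tau>^2/2 in
  the first case and 0 on both sides in the second.\<close>

lemma smult_A_mat: "complex_of_real (\<tau>\<^sup>2) \<cdot>\<^sub>m A_mat N L R \<tau>
    = mat_diag (grid_size N) (\<lambda>m. complex_of_real (cos_quot (wave_norm N L R m) \<tau>))"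
proof -
  have "complex_of_real (\<tau>\<^sup>2) * (if complex_of_real ((r * \<tau>)\<^sup>2) = 0 then - 1 / 2
      else (cosh (csqrt (- complex_of_real ((r * \<tau>)\<^sup>2))) - 1) / complex_of_real ((r * \<tau>)\<^sup>2))
      = complex_of_real (cos_quot r \<tau>)" for r
    unfolding cosh_csqrt by (auto simp: cos_quot_def power_mult_distrib)
  then show ?thesis
    unfolding A_mat_def Psi_eq diag_apply_mat_diag mat_diag_smult by simp
qed

lemma smult_B_mat: "complex_of_real \<tau> \<cdot>\<^sub>m B_mat N L R \<tau>
    = mat_diag (grid_size N) (\<lambda>m. complex_of_real (sin_quot (wave_norm N L R m) \<tau>))"
proof -
  have "complex_of_real \<tau> * (if complex_of_real ((r * \<tau>)\<^sup>2) = 0 then 1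
      else sinh (csqrt (- complex_of_real ((r * \<tau>)\<^sup>2))) / csqrt (- complex_of_real ((r * \<tau>)\<^sup>2)))
      = complex_of_real (sin_quot r \<tau>)" for r
    using sinh_csqrt[of "r * \<tau>"] by (cases "r = 0"; cases "\<tau> = 0") (simp_all add: sin_quot_def)
  then show ?thesis
    unfolding B_mat_def Psi_eq diag_apply_mat_diag mat_diag_smult by simp
qed

lemma smult_mult_A_mat:
  "complex_of_real (\<tau>\<^sup>2) \<cdot>\<^sub>m (mat_diag (grid_size N) f * A_mat N L R \<tau>)
    = mat_diag (grid_size N) (\<lambda>m. f m * complex_of_real (cos_quot (wave_norm N L R m) \<tau>))"
proof -
  have "A_mat N L R \<tau> \<in> carrier_mat (grid_size N) (grid_size N)"
    by (simp add: A_mat_def Psi_eq diag_apply_mat_diag)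
  note mult_smult_distrib[OF mat_diag_dim this, of f "complex_of_real (\<tau>\<^sup>2)", symmetric]
  then show ?thesis unfolding smult_A_mat mat_diag_diag .
qed

lemma smult_mult_B_mat:
  "(\<i> * complex_of_real \<tau>) \<cdot>\<^sub>m (mat_diag (grid_size N) f * B_mat N L R \<tau>)
    = mat_diag (grid_size N) (\<lambda>m. \<i> * f m * complex_of_real (sin_quot (wave_norm N L R m) \<tau>))"
proof -
  have B: "B_mat N L R \<tau> \<in> carrier_mat (grid_size N) (grid_size N)"
    by (simp add: B_mat_def Psi_eq diag_apply_mat_diag)
  have smult: "(\<i> * c) \<cdot>\<^sub>m M = \<i> \<cdot>\<^sub>m (c \<cdot>\<^sub>m M)" for c and M :: "complex mat"
    by auto
  note distrib = mult_smult_distrib[OF mat_diag_dim B, of f "complex_of_real \<tau>"]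
  have "complex_of_real \<tau> \<cdot>\<^sub>m (mat_diag (grid_size N) f * B_mat N L R \<tau>)
    = mat_diag (grid_size N) (\<lambda>m. f m * complex_of_real (sin_quot (wave_norm N L R m) \<tau>))"
    unfolding distrib[symmetric] smult_B_mat mat_diag_diag ..
  then show ?thesis
    by (simp add: smult mat_diag_smult mult.assoc)
qed

lemma c_diag_eq: "c_diag N L R \<tau> v w = mat_diag (grid_size N) (\<lambda>m. complex_of_real
    (1 + ((wave_vec N L R m v)\<^sup>2 + (wave_vec N L R m w)\<^sup>2) * cos_quot (wave_norm N L R m) \<tau>))"
  unfolding c_diag_def Om_eq mat_diag_diag mat_diag_add smult_mult_A_mat one_mat_diag
  by (simp add: power2_eq_square)

lemma c_off_eq: "c_off N L R \<tau> v w = mat_diag (grid_size N) (\<lambda>m. complex_of_real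
    (- (wave_vec N L R m v * wave_vec N L R m w) * cos_quot (wave_norm N L R m) \<tau>))"
proof -
  have "- complex_of_real (\<tau>\<^sup>2) \<cdot>\<^sub>m M = - (complex_of_real (\<tau>\<^sup>2) \<cdot>\<^sub>m M)" for M
    by auto
  then show ?thesis
    unfolding c_off_def Om_eq mat_diag_diag by (simp only: smult_mult_A_mat mat_diag_uminus) simp
qed

lemma s_off_eq: "s_off N L R \<tau> w = mat_diag (grid_size N)
    (\<lambda>m. \<i> * wave_vec N L R m w * sin_quot (wave_norm N L R m) \<tau>)"
  by (simp add: s_off_def Om_eq smult_mult_B_mat)

lemma row_mat_diag_scalar_prod:
  assumes "dim_vec x = n" "i < n"
  shows "Matrix.row (mat_diag n f) i \<bullet> x = f i * (x $ i :: complex)"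
  using assms by (simp add: mat_diag_def scalar_prod_def if_distrib[of "\<lambda>c. c * _"] cong: if_cong)

lemma dim_row_mat_diag [simp]: "dim_row (mat_diag n f) = n"
  by (simp add: mat_diag_def)

text \<open>The blocks form 1 + a X^2, because X^2 = |\<kappa>|^2 I - \<kappa> \<kappa>^T.\<close>

lemma block_mult_c_mat_index:
  assumes "\<And>w. dim_vec (V w) = grid_size N" "m < grid_size N"
  shows "block_mult (c_mat N L R \<tau>) V w $ m = V w $ m + cos_quot (wave_norm N L R m) \<tau>
    * curl_symbol (wave_vec N L R m) (curl_symbol (wave_vec N L R m) (\<lambda>w. V w $ m)) w"
  using assms by (cases w)
      (simp_all add: block_mult_def c_diag_eq c_off_eq row_mat_diag_scalar_prod
        algebra_simps power2_eq_square)

text \<open>The sign pattern of the blocks is that of the cross product matrix, so they form b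
  X.\<close>

lemma block_mult_s_mat_index:
  assumes "\<And>w. dim_vec (V w) = grid_size N" "m < grid_size N"
  shows "block_mult (s_mat N L R \<tau>) V w $ m = sin_quot (wave_norm N L R m) \<tau>
    * curl_symbol (wave_vec N L R m) (\<lambda>w. V w $ m) w"
  using assms by (cases w)
      (simp_all add: block_mult_def s_off_eq zero_mat_diag mat_diag_uminus
        row_mat_diag_scalar_prod algebra_simps)

section \<open>Time derivative of the rotation\<close>

context
  fixes \<kappa> :: "axis \<Rightarrow> real" and u v :: "axis \<Rightarrow> complex" and r \<sigma> t :: real and S :: "real set"
  assumes r: "r\<^sup>2 = norm_sq3 \<kappa>"
begin

lemma cos_quot_deriv_scaled:
  "((\<lambda>s. cos_quot r (s * \<sigma>)) has_real_derivative - sin_quot r (t * \<sigma>) * \<sigma>) (at t within S)"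
  by (rule DERIV_chain'[OF _ cos_quot_deriv]) (auto intro!: derivative_eq_intros)

lemma sin_quot_deriv_scaled:
  "((\<lambda>s. sin_quot r (s * \<sigma>)) has_real_derivative (1 + r\<^sup>2 * cos_quot r (t * \<sigma>)) * \<sigma>) (at t within S)"
  by (rule DERIV_chain'[OF _ sin_quot_deriv]) (auto intro!: derivative_eq_intros)

text \<open>The common shape of \<open>rot_H\<close> and \<open>rot_E\<close> in time: fixed vectors
  with the two trigonometric coefficients.\<close>

lemma combination_deriv:
  fixes x y z :: complex
  shows "((\<lambda>s. x + complex_of_real (cos_quot r (s * \<sigma>)) * y + complex_of_real (sin_quot r (s * \<sigma>)) * z)
    has_vector_derivative
      complex_of_real (- sin_quot r (t * \<sigma>) * \<sigma>) * y
      + complex_of_real ((1 + norm_sq3 \<kappa> * cos_quot r (t * \<sigma>)) * \<sigma>) * z) (at t within S)"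
  unfolding r[symmetric]
  by (auto intro!: derivative_eq_intros cos_quot_deriv_scaled sin_quot_deriv_scaled)

text \<open>X commutes with its cosine and sine, so the derivative is the same rotation applied to
  (- \<sigma> X v, \<sigma> X u); hence \<open>rot_energy\<close> covers it too.\<close>

lemma rot_H_deriv:
  "((\<lambda>s. rot_H \<kappa> (cos_quot r (s * \<sigma>)) (sin_quot r (s * \<sigma>)) u v w) has_vector_derivative
    rot_H \<kappa> (cos_quot r (t * \<sigma>)) (sin_quot r (t * \<sigma>))
      (\<lambda>w. of_real (- \<sigma>) * curl_symbol \<kappa> v w) (\<lambda>w. of_real \<sigma> * curl_symbol \<kappa> u w) w) (at t within S)"
  using combination_deriv[of "u w" "curl_symbol \<kappa> (curl_symbol \<kappa> u) w" "- curl_symbol \<kappa> v w"]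
  unfolding rot_H_def curl_symbol_scale curl_symbol_cube
  by (simp add: algebra_simps)

lemma rot_E_deriv:
  "((\<lambda>s. rot_E \<kappa> (cos_quot r (s * \<sigma>)) (sin_quot r (s * \<sigma>)) u v w) has_vector_derivative
    rot_E \<kappa> (cos_quot r (t * \<sigma>)) (sin_quot r (t * \<sigma>))
      (\<lambda>w. of_real (- \<sigma>) * curl_symbol \<kappa> v w) (\<lambda>w. of_real \<sigma> * curl_symbol \<kappa> u w) w) (at t within S)"
  unfolding rot_E_def curl_symbol_scale curl_symbol_cube
  by (rule has_vector_derivative_eq_rhs[OF combination_deriv]) (simp add: algebra_simps)

end

section \<open>Energies as sums over modes\<close>

text \<open>A constant matrix commutes with differentiation in time, so derivatives can be taken
  mode by mode.\<close>

lemma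
  assumes U: "U \<in> carrier_mat n M" and t: "t \<ge> 0"
    and F: "\<And>s w. F s w = U *\<^sub>v Matrix.vec M (f s w)"
    and deriv: "\<And>w m. m < M \<Longrightarrow> ((\<lambda>s. f s w m) has_vector_derivative f' w m) (at t within {0..})"
  shows time_differentiable_mult_mat_vec: "time_differentiable F t"
    and ddt_mult_mat_vec: "ddt F t w = U *\<^sub>v Matrix.vec M (f' w)"
proof -
  have dim: "dim_vec (F s w) = n" for s w using U by (simp add: F)
  have coeff: "(U *\<^sub>v Matrix.vec M g) $ i = (\<Sum>m<M. U $$ (i, m) * g m)" if "i < n" for g i
    using U that by (simp add: scalar_prod_def lessThan_atLeast0)
  have D: "((\<lambda>s. F s w $ i) has_vector_derivative (\<Sum>m<M. U $$ (i, m) * f' w m)) (at t within {0..})"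
    if "i < n" for w i
    unfolding F coeff[OF that]
    by (intro has_vector_derivative_sum has_vector_derivative_mult_right deriv) simp
  then show "time_differentiable F t"
    unfolding time_differentiable_def dim by (blast intro: differentiableI_vector)
  \<comment> \<open>Approach from the right makes even t = 0 a limit point of \<open>{0..}\<close>,
    so the derivative within that set is unique.\<close>
  have "t islimpt {t<..<t + 1}" by (simp add: islimpt_greaterThanLessThan1)
  then have "t islimpt {0..}" by (rule islimpt_subset) (use t in auto)
  then have "at t within {0..} \<noteq> bot" by (simp add: trivial_limit_within)
  then show "ddt F t w = U *\<^sub>v Matrix.vec M (f' w)"
    using U by (auto simp: ddt_def dim coeff vector_derivative_within[OF _ D] simp del: index_mult_mat_vec)
qed

text \<open>The weights \<mu> and \<epsilon> cancel the divisions by their square roots; what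
  remains is free of \<tau>.\<close>

lemma rot_energy_trig:
  fixes u v :: "axis \<Rightarrow> complex" and r \<tau> \<epsilon> \<mu> :: real
  assumes "r\<^sup>2 = norm_sq3 \<kappa>" "\<epsilon> > 0" "\<mu> > 0"
  defines "h \<equiv> \<lambda>w. rot_H \<kappa> (cos_quot r \<tau>) (sin_quot r \<tau>) u v w / of_real (sqrt \<mu>)"
    and "e \<equiv> \<lambda>w. rot_E \<kappa> (cos_quot r \<tau>) (sin_quot r \<tau>) u v w / of_real (sqrt \<epsilon>)"
  shows "of_real (\<mu> / 2) * inner3 h h + of_real (\<epsilon> / 2) * inner3 e e
    = (inner3 u u + inner3 v v) / 2"
proof -
  have scale: "of_real (c / 2) * inner3 (\<lambda>w. p w / of_real (sqrt c)) (\<lambda>w. p w / of_real (sqrt c))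
      = inner3 p p / 2" if "c > 0" for c p
  proof -
    have "complex_of_real (sqrt c) * complex_of_real (sqrt c) = of_real c"
      using that by (simp flip: of_real_mult)
    then show ?thesis using that by (simp add: inner3_def field_simps)
  qed
  show ?thesis
    unfolding h_def e_def scale[OF assms(2)] scale[OF assms(3)]
    using rot_energy[of "cos_quot r \<tau>" \<kappa> "sin_quot r \<tau>" u v] cos_sin_quot_rel[of r \<tau>]
    by (simp add: assms(1) flip: add_divide_distrib)
qed

text \<open>Parseval's identity turns the energies into sums of the mode energies
  \<open>q m\<close>, and \<open>D\<close> multiplies mode m by its eigenvalue. In
  \<open>energy5\<close> the eigenvalue is conjugated because \<open>D\<close> acts in the second
  argument.\<close>

lemma
  fixes e h :: "axis \<Rightarrow> nat \<Rightarrow> complex" and \<epsilon> \<mu> :: real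
  assumes U: "orthogonal_columns (grid_size N) c U"
    and E: "\<And>w. E t w = U *\<^sub>v Matrix.vec (grid_size N) (e w)"
    and H: "\<And>w. H t w = U *\<^sub>v Matrix.vec (grid_size N) (h w)"
  defines "q \<equiv> \<lambda>m. of_real (\<mu> / 2) * inner3 (\<lambda>w. h w m) (\<lambda>w. h w m)
    + of_real (\<epsilon> / 2) * inner3 (\<lambda>w. e w m) (\<lambda>w. e w m)"
  shows energy1_modes: "energy1 \<epsilon> \<mu> N E H t = c / of_nat (grid_size N) * (\<Sum>m<grid_size N. q m)"
    and energy3_modes: "D \<in> carrier_mat (grid_size N) (grid_size N) \<Longrightarrow>
      D * U = U * mat_diag (grid_size N) \<sigma> \<Longrightarrow>
      energy3 \<epsilon> \<mu> N D E H t
        = c / of_nat (grid_size N) * (\<Sum>m<grid_size N. \<sigma> m * cnj (\<sigma> m) * q m)"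
    and energy5_modes: "D \<in> carrier_mat (grid_size N) (grid_size N) \<Longrightarrow>
      D * U = U * mat_diag (grid_size N) \<sigma> \<Longrightarrow>
      energy5 \<epsilon> \<mu> N D E H t
        = c / of_nat (grid_size N) * (\<Sum>m<grid_size N. cnj (\<sigma> m) * q m)"
proof -
  let ?M = "grid_size N"
  have Uc: "U \<in> carrier_mat ?M ?M" using U by (simp add: orthogonal_columns_def)
  have inner: "grid_inner N (U *\<^sub>v Matrix.vec ?M f) (U *\<^sub>v Matrix.vec ?M g)
      = c / of_nat ?M * (\<Sum>m<?M. f m * cnj (g m))" for f g
    by (simp add: grid_inner_def orthogonal_columns_cscalar_prod[OF U])
  \<comment> \<open>Exchanges the sum over components with the sum over modes, for a common factor
    \<open>d\<close> and mode weights \<open>k\<close>.\<close>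
  have combine: "of_real (\<mu> / 2) * (\<Sum>w\<in>{AX, AY, AZ}. d * (\<Sum>m<?M. k m * (h w m * cnj (h w m))))
      + of_real (\<epsilon> / 2) * (\<Sum>w\<in>{AX, AY, AZ}. d * (\<Sum>m<?M. k m * (e w m * cnj (e w m))))
      = d * (\<Sum>m<?M. k m * q m)" for d k
    by (simp add: q_def inner3_def algebra_simps sum.distrib sum_distrib_left)
  show "energy1 \<epsilon> \<mu> N E H t = c / of_nat ?M * (\<Sum>m<?M. q m)"
    using combine[of "c / of_nat ?M" "\<lambda>_. 1"]
    by (simp add: energy1_def field_inner_def E H inner)
  assume D: "D \<in> carrier_mat ?M ?M" "D * U = U * mat_diag ?M \<sigma>"
  have mult: "D *\<^sub>v (U *\<^sub>v Matrix.vec ?M f) = U *\<^sub>v Matrix.vec ?M (\<lambda>m. \<sigma> m * f m)" for f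
  proof -
    have "D *\<^sub>v (U *\<^sub>v Matrix.vec ?M f) = U *\<^sub>v (mat_diag ?M \<sigma> *\<^sub>v Matrix.vec ?M f)"
      using assoc_mult_mat_vec[OF D(1) Uc vec_carrier, of f]
        assoc_mult_mat_vec[OF Uc mat_diag_dim vec_carrier, of \<sigma> f] D(2) by simp
    also have "mat_diag ?M \<sigma> *\<^sub>v Matrix.vec ?M f = Matrix.vec ?M (\<lambda>m. \<sigma> m * f m)"
      by (intro eq_vecI) (simp_all add: row_mat_diag_scalar_prod)
    finally show ?thesis .
  qed
  show "energy3 \<epsilon> \<mu> N D E H t = c / of_nat ?M * (\<Sum>m<?M. \<sigma> m * cnj (\<sigma> m) * q m)"
    unfolding energy3_def E H mult inner combine[symmetric] by (simp add: mult_ac)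
  show "energy5 \<epsilon> \<mu> N D E H t = c / of_nat ?M * (\<Sum>m<?M. cnj (\<sigma> m) * q m)"
    unfolding energy5_def E H mult inner combine[symmetric] by (simp add: mult_ac)
qed

text \<open>Leaves only three kinds of energy to be expanded, for the trajectories and for their
  derivatives.\<close>

lemma ddt_energies:
  "energy2 \<epsilon> \<mu> N E H = energy1 \<epsilon> \<mu> N (ddt E) (ddt H)"
  "energy4 \<epsilon> \<mu> N D E H = energy3 \<epsilon> \<mu> N D (ddt E) (ddt H)"
  "energy6 \<epsilon> \<mu> N D E H = energy5 \<epsilon> \<mu> N D (ddt E) (ddt H)"
  by (simp_all add: fun_eq_iff energy1_def energy2_def energy3_def energy4_def energy5_def energy6_def)

section \<open>The scheme as a rotation of each Fourier mode\<close>

lemma dim_initial_hat: "dim_vec (initial_hat N L R F0 w) = grid_size N"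
  by (simp add: initial_hat_def kronecker3_def kronecker_def dft_def grid_size_def mult_ac)

text \<open>Scaling the initial data by sqrt \<mu> and sqrt \<epsilon> turns the update into the
  rotation; dividing by the same roots recovers the fields.\<close>

lemma
  fixes \<epsilon> \<mu> t :: real and N :: "axis \<Rightarrow> nat" and L R :: "axis \<Rightarrow> real"
    and E0 H0 :: "axis \<Rightarrow> real \<times> real \<times> real \<Rightarrow> real"
  assumes "\<epsilon> > 0" "\<mu> > 0"
  defines "\<tau> \<equiv> t * (1 / sqrt (\<mu> * \<epsilon>))"
    and "u \<equiv> \<lambda>m w. of_real (sqrt \<mu>) * initial_hat N L R H0 w $ m"
    and "v \<equiv> \<lambda>m w. of_real (sqrt \<epsilon>) * initial_hat N L R E0 w $ m"
  shows H_hat_eq_rot: "H_hat \<epsilon> \<mu> N L R E0 H0 t w = Matrix.vec (grid_size N) (\<lambda>m.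
      rot_H (wave_vec N L R m) (cos_quot (wave_norm N L R m) \<tau>) (sin_quot (wave_norm N L R m) \<tau>)
        (u m) (v m) w / of_real (sqrt \<mu>))" (is ?H)
    and E_hat_eq_rot: "E_hat \<epsilon> \<mu> N L R E0 H0 t w = Matrix.vec (grid_size N) (\<lambda>m.
      rot_E (wave_vec N L R m) (cos_quot (wave_norm N L R m) \<tau>) (sin_quot (wave_norm N L R m) \<tau>)
        (u m) (v m) w / of_real (sqrt \<epsilon>))" (is ?E)
proof -
  \<comment> \<open>The scheme uses a quotient; the product form fits the derivative rules in
    \<open>t * \<sigma>\<close>.\<close>
  have \<tau>: "\<tau> = t / sqrt (\<mu> * \<epsilon>)" by (simp add: \<tau>_def)
  have dims: "dim_vec (block_mult (c_mat N L R \<tau>) V w) = grid_size N"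
      "dim_vec (block_mult (s_mat N L R \<tau>) V w) = grid_size N" for V
    by (cases w; simp add: block_mult_def c_off_eq c_diag_eq s_off_eq)+
  note block = block_mult_c_mat_index[OF dim_initial_hat] block_mult_s_mat_index[OF dim_initial_hat]
  show ?H
    unfolding H_hat_def \<tau>[symmetric]
    using assms(1,2)
    by (intro eq_vecI) (simp_all add: dims block rot_H_def u_def v_def curl_symbol_scale field_simps)
  show ?E
    unfolding E_hat_def \<tau>[symmetric]
    using assms(1,2)
    by (intro eq_vecI) (simp_all add: dims block rot_E_def u_def v_def curl_symbol_scale field_simps)
qed

theorem theorem4p1:
  fixes \<epsilon> \<mu> t_end :: real
    and N :: "axis \<Rightarrow> nat" and L R :: "axis \<Rightarrow> real"
    and E0 H0 :: "axis \<Rightarrow> real \<times> real \<times> real \<Rightarrow> real"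
    and E H :: "real \<Rightarrow> axis \<Rightarrow> complex vec"
  assumes "\<epsilon> > 0" and "\<mu> > 0" and "t_end \<ge> 0"
    and "\<And>w. L w < R w"
    and "\<And>w. 0 < N w \<and> even (N w)"
    and "E = E_scheme \<epsilon> \<mu> N L R E0 H0"
    and "H = H_scheme \<epsilon> \<mu> N L R E0 H0"
  shows "(\<forall>t\<ge>0. time_differentiable E t \<and> time_differentiable H t)
    \<and> energy1 \<epsilon> \<mu> N E H t_end = energy1 \<epsilon> \<mu> N E H 0
    \<and> energy2 \<epsilon> \<mu> N E H t_end = energy2 \<epsilon> \<mu> N E H 0
    \<and> (\<forall>k. energy3 \<epsilon> \<mu> N (grid_diff N L R k) E H t_end = energy3 \<epsilon> \<mu> N (grid_diff N L R k) E H 0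
         \<and> energy4 \<epsilon> \<mu> N (grid_diff N L R k) E H t_end = energy4 \<epsilon> \<mu> N (grid_diff N L R k) E H 0
         \<and> energy5 \<epsilon> \<mu> N (grid_diff N L R k) E H t_end = energy5 \<epsilon> \<mu> N (grid_diff N L R k) E H 0
         \<and> energy6 \<epsilon> \<mu> N (grid_diff N L R k) E H t_end = energy6 \<epsilon> \<mu> N (grid_diff N L R k) E H 0)"
proof -
  define M where "M = grid_size N"
  define U where "U = kronecker3 (\<lambda>v. inv_dft (N v))"
  define \<sigma> where "\<sigma> = 1 / sqrt (\<mu> * \<epsilon>)"
  define \<kappa> where "\<kappa> = wave_vec N L R"
  define r where "r = wave_norm N L R"
  define u where "u = (\<lambda>m w. complex_of_real (sqrt \<mu>) * initial_hat N L R H0 w $ m)"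
  define v where "v = (\<lambda>m w. complex_of_real (sqrt \<epsilon>) * initial_hat N L R E0 w $ m)"
  \<comment> \<open>The initial data whose rotation is the time derivative, as in
    \<open>rot_H_deriv\<close>.\<close>
  define u' where "u' = (\<lambda>m w. of_real (- \<sigma>) * curl_symbol (\<kappa> m) (v m) w)"
  define v' where "v' = (\<lambda>m w. of_real \<sigma> * curl_symbol (\<kappa> m) (u m) w)"
  \<comment> \<open>The data \<open>p\<close>, \<open>q\<close> stay parameters: the pair
    \<open>u\<close>, \<open>v\<close> gives the solution and \<open>u'\<close>, \<open>v'\<close>
    its derivative.\<close>
  define h where "h = (\<lambda>p q t w m. rot_H (\<kappa> m) (cos_quot (r m) (t * \<sigma>)) (sin_quot (r m) (t * \<sigma>))
    (p m) (q m) w / complex_of_real (sqrt \<mu>))"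
  define e where "e = (\<lambda>p q t w m. rot_E (\<kappa> m) (cos_quot (r m) (t * \<sigma>)) (sin_quot (r m) (t * \<sigma>))
    (p m) (q m) w / complex_of_real (sqrt \<epsilon>))"
  have r: "(r m)\<^sup>2 = norm_sq3 (\<kappa> m)" for m by (simp add: r_def \<kappa>_def wave_norm_sq)
  have H: "H t w = U *\<^sub>v Matrix.vec M (h u v t w)" for t w
    unfolding assms(7) H_scheme_def H_hat_eq_rot[OF assms(1,2)] h_def
      U_def M_def u_def v_def \<sigma>_def r_def \<kappa>_def ..
  have E: "E t w = U *\<^sub>v Matrix.vec M (e u v t w)" for t w
    unfolding assms(6) E_scheme_def E_hat_eq_rot[OF assms(1,2)] e_def
      U_def M_def u_def v_def \<sigma>_def r_def \<kappa>_def ..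
  \<comment> \<open>Each direction contributes a factor 1 / N w to the constant.\<close>
  have orth: "orthogonal_columns M (1 / of_nat M) U"
    using orthogonal_columns_kronecker[OF orthogonal_columns_inv_dft
        orthogonal_columns_kronecker[OF orthogonal_columns_inv_dft orthogonal_columns_inv_dft],
        of "N AZ" "N AY" "N AX"]
    by (simp add: U_def M_def kronecker3_def grid_size_def mult_ac)
  then have U: "U \<in> carrier_mat M M" by (simp add: orthogonal_columns_def)
  have h': "((\<lambda>s. h u v s w m) has_vector_derivative h u' v' t w m) (at t within {0..})" for t w m
    unfolding h_def u'_def v'_def by (intro has_vector_derivative_divide rot_H_deriv r)
  have e': "((\<lambda>s. e u v s w m) has_vector_derivative e u' v' t w m) (at t within {0..})" for t w m
    unfolding e_def u'_def v'_def by (intro has_vector_derivative_divide rot_E_deriv r)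
  have td: "time_differentiable E t \<and> time_differentiable H t" if "t \<ge> 0" for t
    using time_differentiable_mult_mat_vec[OF U that E e'] time_differentiable_mult_mat_vec[OF U that H h'] ..
  have E': "ddt E t w = U *\<^sub>v Matrix.vec M (e u' v' t w)" if "t \<ge> 0" for t w
    by (rule ddt_mult_mat_vec[OF U that E e'])
  have H': "ddt H t w = U *\<^sub>v Matrix.vec M (h u' v' t w)" if "t \<ge> 0" for t w
    by (rule ddt_mult_mat_vec[OF U that H h'])
  have mode: "of_real (\<mu> / 2) * inner3 (\<lambda>w. h p q t w m) (\<lambda>w. h p q t w m)
      + of_real (\<epsilon> / 2) * inner3 (\<lambda>w. e p q t w m) (\<lambda>w. e p q t w m)
      = (inner3 (p m) (p m) + inner3 (q m) (q m)) / 2" for p q t m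
    unfolding h_def e_def by (rule rot_energy_trig[OF r assms(1,2)])
  note orth' = orth[unfolded M_def]
  note E_modes = E[unfolded M_def] E'[unfolded M_def] and H_modes = H[unfolded M_def] H'[unfolded M_def]
  have D: "grid_diff N L R k \<in> carrier_mat (grid_size N) (grid_size N)" for k
    unfolding grid_diff_def on_axis_def by (rule kronecker3_carrier) auto
  \<comment> \<open>Once \<open>mode\<close> has removed the time, both sides are the same sum. Fact
    (1) of \<open>E_modes\<close> and \<open>H_modes\<close> concerns the solution, fact (2) its
    derivative.\<close>
  have e12: "energy1 \<epsilon> \<mu> N E H t_end = energy1 \<epsilon> \<mu> N E H 0"
    "energy2 \<epsilon> \<mu> N E H t_end = energy2 \<epsilon> \<mu> N E H 0"
    unfolding ddt_energies
    by (simp_all only: assms(3) order_refl energy1_modes[OF orth' E_modes(1) H_modes(1)]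
        energy1_modes[OF orth' E_modes(2) H_modes(2)] mode)
  have e36: "energy3 \<epsilon> \<mu> N (grid_diff N L R k) E H t_end = energy3 \<epsilon> \<mu> N (grid_diff N L R k) E H 0"
    "energy4 \<epsilon> \<mu> N (grid_diff N L R k) E H t_end = energy4 \<epsilon> \<mu> N (grid_diff N L R k) E H 0"
    "energy5 \<epsilon> \<mu> N (grid_diff N L R k) E H t_end = energy5 \<epsilon> \<mu> N (grid_diff N L R k) E H 0"
    "energy6 \<epsilon> \<mu> N (grid_diff N L R k) E H t_end = energy6 \<epsilon> \<mu> N (grid_diff N L R k) E H 0" for k
  proof -
    \<comment> \<open>The weights come from eigenvalues \<open>s\<close> independent of time, so the
      same argument applies.\<close>
    obtain s where s: "grid_diff N L R k * U = U * mat_diag (grid_size N) s"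
      using grid_diff_mult_kronecker3_inv_dft[of L R N k] assms(4,5) unfolding U_def by blast
    note modes3 = energy3_modes[OF orth' _ _ D s] and modes5 = energy5_modes[OF orth' _ _ D s]
    show "energy3 \<epsilon> \<mu> N (grid_diff N L R k) E H t_end = energy3 \<epsilon> \<mu> N (grid_diff N L R k) E H 0"
      by (simp only: modes3[OF E_modes(1) H_modes(1)] mode)
    show "energy5 \<epsilon> \<mu> N (grid_diff N L R k) E H t_end = energy5 \<epsilon> \<mu> N (grid_diff N L R k) E H 0"
      by (simp only: modes5[OF E_modes(1) H_modes(1)] mode)
    show "energy4 \<epsilon> \<mu> N (grid_diff N L R k) E H t_end = energy4 \<epsilon> \<mu> N (grid_diff N L R k) E H 0"
      unfolding ddt_energies by (simp only: assms(3) order_refl modes3[OF E_modes(2) H_modes(2)] mode)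
    show "energy6 \<epsilon> \<mu> N (grid_diff N L R k) E H t_end = energy6 \<epsilon> \<mu> N (grid_diff N L R k) E H 0"
      unfolding ddt_energies by (simp only: assms(3) order_refl modes5[OF E_modes(2) H_modes(2)] mode)
  qed
  show ?thesis using td e12 e36 by blast
qed

end
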